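(* Let $1\le p<\infty$, $N\ge2$, and for $1\le i\le N$ let $T_i=T_{f_i,\omega^{(i)}}$ be unilateral pseudo-shifts on $\ell^p(\mathbb{N})$ with maps $f_i$ and weights $\omega^{(i)}=(w^{(i)}_{f_i(m)})_m$; let $W^{(i)}_{m,n}=\prod_{\nu=1}^nw^{(i)}_{f_i^\nu(m)}$. The following are equivalent: (i) $T_1,\dots,T_N$ are s-hypercyclic. (ii) $T_1,\dots,T_N$ satisfy the Simultaneous Blow-up/Collapse Criterion. (iii) There is a strictly increasing sequence $(n_k)$ of positive integers such that (a) $|W^{(i)}_{m,n_k}|\to\infty$ as $k\to\infty$ for all $m\in\mathbb{N}$, $1\le i\le N$; and (b) for each $\epsilon>0$, $K,M\in\mathbb{N}$ and nonzero scalars $a_1,\dots,a_M$, there is $k\ge K$ such that for all $1\le i,\ell\le N$ with $i\neq\ell$: $\left|\frac{W^{(i)}_{f_i^{-n_k}(j),n_k}}{W^{(\ell)}_{f_\ell^{-n_k}(j),n_k}}\right|<\epsilon$ whenever $j\in f_\ell^{n_k}([M])\cap f_i^{n_k}(\mathbb{N}\setminus[M])$, and $\left|\frac{W^{(i)}_{f_i^{-n_k}(j),n_k}}{W^{(\ell)}_{f_\ell^{-n_k}(j),n_k}}-\frac{a_{f_i^{-n_k}(j)}}{a_{f_\ell^{-n_k}(j)}}\right|<\epsilon$ whenever $j\in f_\ell^{n_k}([M])\cap f_i^{n_k}([M])$.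
   Context: $\mathbb{N}=\{1,2,\dots\}$; $\{e_m\}$ is the canonical basis of $\ell^p(\mathbb{N})$ over $\mathbb{K}\in\{\mathbb{R},\mathbb{C}\}$. For a strictly increasing $f:\mathbb{N}\to\mathbb{N}$ with $f(1)>1$ and a bounded, nonzero sequence of scalars $\omega=(w_{f(m)})_m$, $T_{f,\omega}(\sum_m\alpha_me_m)=\sum_mw_{f(m)}\alpha_{f(m)}e_m$. $[M]=\{1,\dots,M\}$, $f^n$ the $n$-fold composition, $f(A)=\{f(m):m\in A\}$, $f^{-n}$ the inverse of $f^n$ on $f^n(\mathbb{N})$. Operators $T_1,\dots,T_N$ on $X$ are s-hypercyclic if some $x\in X$ has the closure of $\{(T_1^nx,\dots,T_N^nx):n\in\mathbb{N}\}$ containing the diagonal $\{(y,\dots,y):y\in X\}$ of $\oplus_{i=1}^NX$. They satisfy the Simultaneous Blow-up/Collapse Criterion if there exist an increasing sequence $(n_k)$, a dense $X_0\subset X$ and maps $S_k:X_0\to X$ with $T_i^{n_k}x\to0$ for all $x\in X_0$, $1\le i\le N$, and such that for each $\epsilon>0$, $K\in\mathbb{N}$, $x_0\in X_0$ there is $k\ge K$ with $\|S_k(x_0)\|<\epsilon$ and $\|T_i^{n_k}S_k(x_0)-x_0\|<\epsilon$ for all $i$. *)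

theory Defs
  imports "HOL-Analysis.Analysis"
begin

text \<open>Sequences on \<open>\<nat> = {1,2,...}\<close> are modelled as functions \<open>nat \<Rightarrow> 'k\<close>
  whose value at index 0 is 0 (index 0 is unused).\<close>

definition lp :: "real \<Rightarrow> (nat \<Rightarrow> 'k::real_normed_vector) set" where
  "lp p = {x. x 0 = 0 \<and> summable (\<lambda>m. norm (x m) powr p)}"

definition lp_norm :: "real \<Rightarrow> (nat \<Rightarrow> 'k::real_normed_vector) \<Rightarrow> real" where
  "lp_norm p x = (\<Sum>m. norm (x m) powr p) powr (1 / p)"

definition pseudo_shift_data :: "(nat \<Rightarrow> nat) \<Rightarrow> (nat \<Rightarrow> 'k::real_normed_field) \<Rightarrow> bool" where
  "pseudo_shift_data f w \<longleftrightarrow> strict_mono_on {1..} f \<and> f 1 > 1 \<and>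
      bounded ((\<lambda>m. w (f m)) ` {1..}) \<and> (\<forall>m\<ge>1. w (f m) \<noteq> 0)"

definition pseudo_shift :: "(nat \<Rightarrow> nat) \<Rightarrow> (nat \<Rightarrow> 'k::real_normed_field) \<Rightarrow> (nat \<Rightarrow> 'k) \<Rightarrow> (nat \<Rightarrow> 'k)" where
  "pseudo_shift f w x = (\<lambda>m. if m = 0 then 0 else w (f m) * x (f m))"

definition Wprod :: "(nat \<Rightarrow> nat) \<Rightarrow> (nat \<Rightarrow> 'k::real_normed_field) \<Rightarrow> nat \<Rightarrow> nat \<Rightarrow> 'k" where
  "Wprod f w m n = (\<Prod>\<nu>=1..n. w ((f ^^ \<nu>) m))"

definition finv :: "(nat \<Rightarrow> nat) \<Rightarrow> nat \<Rightarrow> nat \<Rightarrow> nat" where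
  "finv f n j = the_inv_into {1..} (f ^^ n) j"

text \<open>s-hypercyclicity of \<open>T_1,...,T_N\<close> on \<open>\<ell>^p\<close>: some \<open>x\<close> whose orbit
  \<open>{(T_1^n x,...,T_N^n x) : n \<in> \<nat>}\<close> has closure (in \<open>\<oplus>_{i=1}^N \<ell>^p\<close>, product norm
  topology) containing the diagonal; the closure condition is written out metrically.\<close>
definition s_hypercyclic :: "real \<Rightarrow> nat \<Rightarrow> (nat \<Rightarrow> (nat \<Rightarrow> 'k::real_normed_vector) \<Rightarrow> (nat \<Rightarrow> 'k)) \<Rightarrow> bool" where
  "s_hypercyclic p N T \<longleftrightarrow>
     (\<exists>x\<in>lp p. \<forall>y\<in>lp p. \<forall>\<epsilon>>0. \<exists>n\<ge>1. \<forall>i\<in>{1..N}. lp_norm p ((T i ^^ n) x - y) < \<epsilon>)"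

definition simultaneous_blowup_collapse ::
  "real \<Rightarrow> nat \<Rightarrow> (nat \<Rightarrow> (nat \<Rightarrow> 'k::real_normed_vector) \<Rightarrow> (nat \<Rightarrow> 'k)) \<Rightarrow> bool" where
  "simultaneous_blowup_collapse p N T \<longleftrightarrow>
     (\<exists>(nk :: nat \<Rightarrow> nat) (X0 :: (nat \<Rightarrow> 'k) set) (S :: nat \<Rightarrow> (nat \<Rightarrow> 'k) \<Rightarrow> (nat \<Rightarrow> 'k)).
        strict_mono nk \<and> (\<forall>k. nk k \<ge> 1) \<and>
        X0 \<subseteq> lp p \<and> (\<forall>y\<in>lp p. \<forall>\<epsilon>>0. \<exists>x\<in>X0. lp_norm p (x - y) < \<epsilon>) \<and>
        (\<forall>k. \<forall>x\<in>X0. S k x \<in> lp p) \<and>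
        (\<forall>x\<in>X0. \<forall>i\<in>{1..N}. (\<lambda>k. lp_norm p ((T i ^^ nk k) x)) \<longlonglongrightarrow> 0) \<and>
        (\<forall>\<epsilon>>0. \<forall>K. \<forall>x0\<in>X0. \<exists>k\<ge>K. lp_norm p (S k x0) < \<epsilon> \<and>
             (\<forall>i\<in>{1..N}. lp_norm p ((T i ^^ nk k) (S k x0) - x0) < \<epsilon>)))"

definition weight_condition ::
  "nat \<Rightarrow> (nat \<Rightarrow> nat \<Rightarrow> nat) \<Rightarrow> (nat \<Rightarrow> nat \<Rightarrow> 'k::real_normed_field) \<Rightarrow> bool" where
  "weight_condition N f w \<longleftrightarrow>
     (\<exists>nk :: nat \<Rightarrow> nat. strict_mono nk \<and> (\<forall>k. nk k \<ge> 1) \<and>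
        (\<forall>m\<ge>1. \<forall>i\<in>{1..N}. filterlim (\<lambda>k. norm (Wprod (f i) (w i) m (nk k))) at_top sequentially) \<and>
        (\<forall>\<epsilon>>0. \<forall>K. \<forall>M\<ge>1. \<forall>a :: nat \<Rightarrow> 'k. (\<forall>m\<in>{1..M}. a m \<noteq> 0) \<longrightarrow>
           (\<exists>k\<ge>K. \<forall>i\<in>{1..N}. \<forall>l\<in>{1..N}. i \<noteq> l \<longrightarrow>
              (\<forall>j \<in> (f l ^^ nk k) ` {1..M} \<inter> (f i ^^ nk k) ` ({1..} - {1..M}).
                 norm (Wprod (f i) (w i) (finv (f i) (nk k) j) (nk k) /
                       Wprod (f l) (w l) (finv (f l) (nk k) j) (nk k)) < \<epsilon>) \<and>
              (\<forall>j \<in> (f l ^^ nk k) ` {1..M} \<inter> (f i ^^ nk k) ` {1..M}.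
                 norm (Wprod (f i) (w i) (finv (f i) (nk k) j) (nk k) /
                       Wprod (f l) (w l) (finv (f l) (nk k) j) (nk k)
                       - a (finv (f i) (nk k) j) / a (finv (f l) (nk k) j)) < \<epsilon>))))"

end

(* (i) => (iii): let x have an orbit that accumulates on the diagonal, and steer it simultaneously near
   a vector that equals a_1, ..., a_M on [M] and is small but nonzero on M < m <= r. Reading off
   coordinates, W^(i)_{m,n} x_{f_i^n(m)} is close to a_m. Since x_j -> 0 this makes the weights with
   m <= r large, and dividing two such relations with f_i^n(m) = f_l^n(m') gives the ratio conditions.

   (iii) => (ii): take for X_0 the vectors with support exactly some [M], and let S_k x have the value
   x_m / W^(l)_{m,n_k} at f_l^{n_k}(m); wherever several l, m compete for the same position, the ratio
   conditions make the choice immaterial.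

   (ii) => (i): the universal vector is the limit of partial sums, each moved by so little that the
   approximations achieved earlier are kept. This needs a countable set of targets, hence a separable
   scalar field. The type class of the scalars does not say that they are real or complex; that they
   have real dimension at most two follows from the Gelfand-Mazur theorem. *)
theory Submission
  imports Defs "HOL-Computational_Algebra.Fundamental_Theorem_Algebra"
begin

subsection \<open>Real normed fields are separable\<close>

text \<open>In the criterion and in the ratio condition the index k depends on the target vector, so
  a good k cannot be shared between targets, and this shapes each implication. Extracting one
  sequence (n_k) from an orbit needs a list of countably many targets in which every admissible
  vector is approximated at arbitrarily late positions. The maps S_k must be fixed before the
  tolerance is known, so an approximate preimage is built from the time and the vector alone. The
  universal vector receives one correction per target. A value S_k x is merely an element of the
  space, and X_0 is not assumed closed under addition; so each correction is replaced by a nearby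
  element of X_0, and what is carried along is the property that the iterates at the times n_k tend
  to 0, which passes to sums.\<close>

abbreviation of_real_poly :: "real poly \<Rightarrow> 'a::real_algebra_1 poly" where
  "of_real_poly \<equiv> map_poly of_real"

lemma of_real_poly_mult:
  "of_real_poly (p * q) = (of_real_poly p * of_real_poly q :: 'a::{real_algebra_1, comm_ring_1} poly)"
  by (intro poly_eqI) (simp add: coeff_map_poly coeff_mult)

lemma of_real_poly_prod_mset:
  "of_real_poly (\<Prod>x\<in>#A. g x) = (\<Prod>x\<in>#A. of_real_poly (g x) :: 'a::{real_algebra_1, comm_ring_1} poly)"
  by (induction A) (simp_all add: of_real_poly_mult)

lemma of_real_poly_power:
  "of_real_poly (p ^ n) = (of_real_poly p ^ n :: 'a::{real_algebra_1, comm_ring_1} poly)"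
  by (induction n) (simp_all add: of_real_poly_mult)

lemma of_real_poly_diff:
  "of_real_poly (p - q) = (of_real_poly p - of_real_poly q :: 'a::{real_algebra_1, comm_ring_1} poly)"
  by (intro poly_eqI) (simp add: coeff_map_poly)

text \<open>This is \<open>(X - c) * (X - cnj c)\<close>, written with real coefficients so that it
  can be evaluated in any real normed field.\<close>

definition conj_quad :: "complex \<Rightarrow> real poly" where
  "conj_quad c = [:(cmod c)\<^sup>2, - 2 * Re c, 1:]"

lemma of_real_conj_quad: "of_real_poly (conj_quad c) = [:- c, 1:] * [:- cnj c, 1:]"
  unfolding conj_quad_def cmod_power2
  by (simp add: map_poly_pCons complex_eq_iff flip: power2_eq_square)

lemma poly_of_real_conj_quad:
  "poly (of_real_poly (conj_quad c)) z
     = z\<^sup>2 - of_real (2 * Re c) * z + of_real ((cmod c)\<^sup>2 :: real)"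
  for z :: "'a::real_normed_field"
  by (simp add: conj_quad_def map_poly_pCons power2_eq_square algebra_simps)

text \<open>Conjugation fixes a polynomial with real coefficients, so conjugating its factorization
  gives a second one. Multiplying the two pairs each root with its conjugate, which avoids sorting
  the roots into real and nonreal ones; this is why the square appears.\<close>

lemma square_eq_prod_conj_quad:
  fixes P :: "real poly"
  assumes "lead_coeff P = 1"
  obtains A where "size A = degree P" "P * P = (\<Prod>x\<in>#A. conj_quad x)"
    "\<And>x. poly (of_real_poly P) x = 0 \<Longrightarrow> x \<in># A"
proof -
  let ?P = "of_real_poly P :: complex poly"
  have lc: "lead_coeff ?P = 1"
    using assms by (subst lead_coeff_map_poly_nz) auto
  have P0: "?P \<noteq> 0" using lc by auto
  obtain A where A: "size A = degree ?P" "?P = (\<Prod>x\<in>#A. [:-x, 1:])"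
    using alg_closed_imp_factorization[OF P0] lc by auto
  have cnjP: "map_poly cnj ?P = ?P"
    by (intro poly_eqI) (simp add: coeff_map_poly)
  have "map_poly cnj (\<Prod>x\<in>#B. [:-x, 1:]) = (\<Prod>x\<in>#B. [:-cnj x, 1:])" for B
  proof (induction B)
    case (add x B)
    have "map_poly cnj (p * q) = map_poly cnj p * map_poly cnj q" for p q
      by (intro poly_eqI) (simp add: coeff_map_poly coeff_mult)
    then show ?case using add by (simp add: map_poly_pCons del: mult_pCons_left)
  qed simp
  then have "?P = (\<Prod>x\<in>#A. [:-cnj x, 1:])" using A(2) cnjP by metis
  then have "of_real_poly (P * P) = (of_real_poly (\<Prod>x\<in>#A. conj_quad x) :: complex poly)"
    using A(2) by (simp only: of_real_poly_mult of_real_poly_prod_mset of_real_conj_quad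
        prod_mset.distrib)
  then have "P * P = (\<Prod>x\<in>#A. conj_quad x)"
    by (auto simp: poly_eq_iff coeff_map_poly)
  moreover have "x \<in># A" if "poly ?P x = 0" for x
  proof -
    have "poly ?P x = (\<Prod>y\<in>#A. x - y)"
      by (simp add: A(2) poly_prod_mset multiset.map_comp o_def)
    then show ?thesis using that by auto
  qed
  moreover have "size A = degree P" using A(1) by (simp add: degree_map_poly)
  ultimately show ?thesis using that by blast
qed

text \<open>The norm is multiplicative, so the right-hand side is the product of \<open>h\<close>
  over the \<open>degree P\<close> roots. The factor of \<open>\<gamma>\<close> is kept, and each of
  the others is at least \<open>m\<close>.\<close>

lemma norm_poly_lower_bound:
  fixes z :: "'a::real_normed_field" and P :: "real poly"
  defines "h \<equiv> \<lambda>c. norm (poly (of_real_poly (conj_quad c)) z)"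
  assumes "lead_coeff P = 1" "poly (of_real_poly P) \<gamma> = (0::complex)"
    and "m > 0" "\<And>c. m \<le> h c"
  shows "h \<gamma> * m ^ (degree P - 1) \<le> (norm (poly (of_real_poly P) z))\<^sup>2"
proof -
  obtain A where A: "size A = degree P" "P * P = (\<Prod>x\<in>#A. conj_quad x)" "\<gamma> \<in># A"
    using square_eq_prod_conj_quad[OF assms(2)] assms(3) by metis
  have ge: "m ^ size B \<le> (\<Prod>x\<in>#B. h x)" for B
    by (induction B) (use assms(4,5) in \<open>auto intro!: mult_mono order.trans[OF _ assms(5)]\<close>)
  have "(norm (poly (of_real_poly P) z))\<^sup>2 = norm (poly (of_real_poly (P * P)) z)"
    by (simp add: of_real_poly_mult norm_mult power2_eq_square)
  also have "\<dots> = (\<Prod>x\<in>#A. h x)"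
    unfolding A(2) h_def of_real_poly_prod_mset
    by (induction A) (auto simp: norm_mult)
  also have "\<dots> = h \<gamma> * (\<Prod>x\<in>#A - {#\<gamma>#}. h x)"
    using A(3) by (metis insert_DiffM image_mset_add_mset prod_mset.add_mset)
  also have "\<dots> \<ge> h \<gamma> * m ^ (degree P - 1)"
    using ge[of "A - {#\<gamma>#}"] A(1,3) by (intro mult_left_mono) (auto simp: size_Diff_singleton h_def)
  finally show ?thesis .
qed


text \<open>Division by \<open>m ^ (2 * n)\<close> leaves
  \<open>h / m \<le> (1 + (1 / 2) ^ n)\<^sup>2\<close>, whose right side tends to 1.\<close>

lemma power_ratio_bound:
  fixes h m :: real
  assumes "m > 0" "\<And>n. n \<ge> 1 \<Longrightarrow> h * m ^ (2 * n - 1) \<le> (m ^ n + (m / 2) ^ n)\<^sup>2"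
  shows "h \<le> m"
proof -
  have "h / m \<le> (1 + (1 / 2) ^ n)\<^sup>2" if "n \<ge> 1" for n
  proof -
    have e: "m ^ n * m ^ n = m ^ (2 * n - 1) * m"
      using that by (simp add: power_add[symmetric] mult_2 flip: power_Suc2)
    have "h / m * (m ^ n * m ^ n) = h * m ^ (2 * n - 1)"
      unfolding e using \<open>m > 0\<close> by simp
    also have "\<dots> \<le> (m ^ n * (1 + (1 / 2) ^ n))\<^sup>2"
      using assms(2)[OF that] by (simp add: power_divide algebra_simps)
    also have "\<dots> = (1 + (1 / 2) ^ n)\<^sup>2 * (m ^ n * m ^ n)"
      by (simp add: power2_eq_square algebra_simps)
    finally show ?thesis
      by (rule mult_right_le_imp_le) (use \<open>m > 0\<close> in simp)
  qed
  moreover have "(\<lambda>n. (1 + (1 / 2 :: real) ^ n)\<^sup>2) \<longlonglongrightarrow> (1 + 0)\<^sup>2"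
    by (intro tendsto_intros LIMSEQ_power_zero) simp
  ultimately have "h / m \<le> (1 + 0)\<^sup>2"
    by (intro LIMSEQ_le_const) auto
  then show ?thesis using \<open>m > 0\<close> by simp
qed

text \<open>Tornheim's elementary argument for the Gelfand--Mazur theorem. Let \<open>h(c)\<close> be the norm at \<open>z\<close> of the
  real quadratic \<open>q\<close> with roots \<open>c\<close> and its conjugate, suppose that its minimum \<open>m\<close> is positive, and take
  a minimiser \<open>c\<close> of maximal modulus. The real polynomial \<open>q\<^sup>n - (-m/2)\<^sup>n\<close> has a root \<open>\<gamma>\<close> with
  \<open>|\<gamma>| > |c|\<close>, so \<open>h(\<gamma>) > m\<close>; factoring the square of that polynomial into real quadratics gives
  \<open>h(\<gamma>) m\<^sup>2\<^sup>n\<^sup>-\<^sup>1 \<le> (m\<^sup>n + (m/2)\<^sup>n)\<^sup>2\<close>, and \<open>n \<rightarrow> \<infinity>\<close> yields \<open>h(\<gamma>) \<le> m\<close>.\<close>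

lemma ex_conj_quad_root:
  fixes z :: "'a::real_normed_field"
  shows "\<exists>c. poly (of_real_poly (conj_quad c)) z = 0"
proof -
  define h where "h = (\<lambda>c. norm (poly (of_real_poly (conj_quad c)) z))"
  \<comment> \<open>If \<open>cmod c > 3 * norm z\<close>, then \<open>h c\<close> is at least
    \<open>(cmod c - norm z)\<^sup>2 - 2 * (norm z)\<^sup>2\<close>, which exceeds
    \<open>h 0 = (norm z)\<^sup>2\<close>; so the minimum over this disc is global.\<close>
  define R where "R = 3 * norm z"
  have h_eq: "h c = norm (z\<^sup>2 - of_real (2 * Re c) * z + of_real ((cmod c)\<^sup>2 :: real))" for c
    by (simp only: h_def poly_of_real_conj_quad)
  have cont: "continuous_on S h" for S
    unfolding h_eq by (intro continuous_intros)
  have "compact (cball (0::complex) R)" "cball (0::complex) R \<noteq> {}"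
    by (simp_all add: R_def)
  from continuous_attains_inf[OF this cont] obtain c1 where
    c1: "c1 \<in> cball 0 R" "\<And>c. c \<in> cball 0 R \<Longrightarrow> h c1 \<le> h c" by blast
  define m where "m = h c1"
  have far: "h c > m" if "cmod c > R" for c
  proof -
    have "m \<le> h 0" unfolding m_def by (rule c1(2)) (simp add: R_def)
    also have "h 0 = (norm z)\<^sup>2" by (simp add: h_eq norm_power)
    finally have "m \<le> (norm z)\<^sup>2" .
    have pos: "2 * norm z < cmod c - norm z" using that by (simp add: R_def)
    then have "(2 * norm z)\<^sup>2 < (cmod c - norm z)\<^sup>2"
      by (intro power_strict_mono) auto
    then have "3 * (norm z)\<^sup>2 < (cmod c)\<^sup>2 - 2 * cmod c * norm z"
      by (simp add: power2_diff power_mult_distrib)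
    moreover have "0 \<le> (norm z)\<^sup>2" by simp
    ultimately have "(norm z)\<^sup>2 < (cmod c)\<^sup>2 - 2 * cmod c * norm z - (norm z)\<^sup>2"
      by linarith
    also have "2 * \<bar>Re c\<bar> * norm z \<le> 2 * cmod c * norm z"
      by (intro mult_right_mono mult_left_mono abs_Re_le_cmod) auto
    then have "(cmod c)\<^sup>2 - 2 * cmod c * norm z - (norm z)\<^sup>2
        \<le> (cmod c)\<^sup>2 - norm (z\<^sup>2 - of_real (2 * Re c) * z)"
      using norm_triangle_ineq4[of "z\<^sup>2" "of_real (2 * Re c) * z"]
      by (simp add: norm_mult norm_power)
    also have "\<dots> \<le> h c"
      unfolding h_eq
      using norm_triangle_ineq4[of "z\<^sup>2 - of_real (2 * Re c) * z + of_real ((cmod c)\<^sup>2 :: real)"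
          "z\<^sup>2 - of_real (2 * Re c) * z"]
      by (simp add: norm_power)
    finally show ?thesis using \<open>m \<le> (norm z)\<^sup>2\<close> by simp
  qed
  have m_le: "m \<le> h c" for c
    using far[of c] c1(2)[of c] by (cases "cmod c > R") (auto simp: m_def)
  define Z where "Z = {c \<in> cball 0 R. h c = m}"
  have "compact Z"
  proof -
    have "closed {c \<in> cball 0 R. h c = m}"
      by (intro continuous_closed_preimage_constant cont closed_cball)
    then show ?thesis unfolding Z_def
      by (metis (no_types, lifting) bounded_cball bounded_subset compact_eq_bounded_closed mem_Collect_eq subsetI)
  qed
  moreover have "Z \<noteq> {}" using c1(1) by (auto simp: Z_def m_def)
  ultimately obtain c0 where c0: "c0 \<in> Z" "\<And>c. c \<in> Z \<Longrightarrow> cmod c \<le> cmod c0"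
    using continuous_attains_sup[of Z cmod] continuous_on_norm_id by blast
  show ?thesis
  proof (rule ccontr)
    assume "\<nexists>c. poly (of_real_poly (conj_quad c)) z = 0"
    then have "m > 0" by (simp add: m_def h_def)
    \<comment> \<open>Enlarging the squared imaginary part by \<open>e\<close> raises the modulus
      and makes \<open>conj_quad c0\<close> take the value \<open>-e\<close> at
      \<open>\<gamma>\<close>, which is thus a root of \<open>P\<close> below. Halving
      \<open>m\<close> makes \<open>e ^ n\<close> negligible against \<open>m ^ n\<close>.\<close>
    define e where "e = m / 2"
    define \<gamma> where "\<gamma> = Complex (Re c0) (sqrt ((Im c0)\<^sup>2 + e))"
    have e: "e > 0" using \<open>m > 0\<close> by (simp add: e_def)
    have \<gamma>2: "(cmod \<gamma>)\<^sup>2 = (cmod c0)\<^sup>2 + e"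
      using e by (simp add: cmod_power2 \<gamma>_def)
    then have "cmod c0 < cmod \<gamma>"
      using e by (intro power2_less_imp_less[of "cmod c0" "cmod \<gamma>"]) simp_all
    then have "\<gamma> \<notin> Z" using c0(2)[of \<gamma>] by (meson not_le)
    then have "h \<gamma> > m"
      using far[of \<gamma>] m_le[of \<gamma>] unfolding Z_def mem_cball_0 mem_Collect_eq
      by (meson not_le order_le_less)
    moreover have "h \<gamma> \<le> m"
    proof (rule power_ratio_bound[OF \<open>m > 0\<close>])
      fix n :: nat assume "n \<ge> 1"
      define P where "P = conj_quad c0 ^ n - [:(-e) ^ n:]"
      have deg: "degree (conj_quad c0 ^ n) = 2 * n"
        by (subst degree_power_eq) (simp_all add: conj_quad_def)
      then have degP: "degree P = 2 * n"
        unfolding P_def diff_conv_add_uminus using \<open>n \<ge> 1\<close>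
          by (subst degree_add_eq_left) simp_all
      have lcP: "lead_coeff P = 1"
      proof -
        have "lead_coeff (conj_quad c0 ^ n) = 1"
          by (simp add: lead_coeff_power conj_quad_def)
        then show ?thesis unfolding degP using deg \<open>n \<ge> 1\<close>
          by (simp add: P_def coeff_pCons split: nat.splits)
      qed
      have ev: "poly (of_real_poly P) x = poly (of_real_poly (conj_quad c0)) x ^ n - of_real ((-e) ^ n)"
        for x :: "'b::real_normed_field"
        by (simp add: P_def of_real_poly_diff of_real_poly_power map_poly_pCons)
      have "poly (of_real_poly (conj_quad c0)) \<gamma> = of_real (- e)"
        using e unfolding of_real_conj_quad
        by (simp add: \<gamma>_def complex_eq_iff power2_eq_square algebra_simps)
      then have "poly (of_real_poly P) \<gamma> = 0"
        unfolding ev by (simp del: of_real_minus)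
      then have "h \<gamma> * m ^ (degree P - 1) \<le> (norm (poly (of_real_poly P) z))\<^sup>2"
        unfolding h_def using m_le \<open>m > 0\<close> lcP
        by (intro norm_poly_lower_bound) (auto simp: h_def)
      also have "\<dots> \<le> (m ^ n + (m / 2) ^ n)\<^sup>2"
      proof (rule power_mono)
        have "norm (poly (of_real_poly P) z) \<le> h c0 ^ n + e ^ n"
          unfolding ev h_def norm_power[symmetric]
          by (rule order.trans[OF norm_triangle_ineq4]) (use e in \<open>simp add: norm_power power_abs\<close>)
        then show "norm (poly (of_real_poly P) z) \<le> m ^ n + (m / 2) ^ n"
          using c0(1) by (simp add: Z_def e_def)
      qed simp
      finally show "h \<gamma> * m ^ (2 * n - 1) \<le> (m ^ n + (m / 2) ^ n)\<^sup>2" by (simp add: degP)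
    qed
    ultimately show False by simp
  qed
qed

text \<open>Completing the square in \<open>poly (of_real_poly (conj_quad c)) z = 0\<close> gives
  \<open>(z - s)\<^sup>2 = - t\<^sup>2\<close> with real \<open>s\<close>, \<open>t\<close>. If -1
  has a square root \<open>b\<close>, then \<open>z\<close> is \<open>s + t * b\<close> or
  \<open>s - t * b\<close>; otherwise \<open>t = 0\<close>, every \<open>z\<close> is real, and
  \<open>b = 0\<close> serves.\<close>

lemma real_normed_field_two_dimensional:
  "\<exists>b::'a::real_normed_field. \<forall>z::'a. \<exists>s t :: real. z = of_real s + of_real t * b"
proof -
  have sq: "\<exists>s t::real. (z - of_real s)\<^sup>2 = - (of_real t)\<^sup>2" for z :: 'a
  proof -
    obtain c where "poly (of_real_poly (conj_quad c)) z = 0" using ex_conj_quad_root by blast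
    then have "(z - of_real (Re c))\<^sup>2 = - (of_real (Im c))\<^sup>2"
      unfolding poly_of_real_conj_quad cmod_power2
      by (simp add: power2_eq_square algebra_simps add_eq_0_iff)
    then show ?thesis by blast
  qed
  show ?thesis
  proof (cases "\<exists>b::'a. b\<^sup>2 = -1")
    case True
    then obtain b :: 'a where b: "b\<^sup>2 = -1" by blast
    have "\<exists>s t::real. z = of_real s + of_real t * b" for z
    proof -
      obtain s t :: real where "(z - of_real s)\<^sup>2 = - (of_real t)\<^sup>2" using sq by blast
      then have "(z - of_real s)\<^sup>2 = (of_real t * b)\<^sup>2" by (simp add: power_mult_distrib b)
      then have "z - of_real s = of_real t * b \<or> z - of_real s = - (of_real t * b)"
        by (simp add: power2_eq_iff)
      then show ?thesis
        by (metis add.commute diff_add_cancel mult_minus_left of_real_minus)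
    qed
    then show ?thesis by blast
  next
    case False
    have "\<exists>s t::real. z = of_real s + of_real t * 0" for z :: 'a
    proof -
      obtain s t :: real where st: "(z - of_real s)\<^sup>2 = - (of_real t)\<^sup>2" using sq by blast
      have "t = 0"
      proof (rule ccontr)
        assume "t \<noteq> 0"
        then have "((z - of_real s) / of_real t)\<^sup>2 = -1" by (simp add: power_divide st)
        then show False using False by blast
      qed
      then show ?thesis using st by (intro exI[of _ s]) simp
    qed
    then show ?thesis by blast
  qed
qed

text \<open>Rational combinations of 1 and \<open>b\<close> are dense. Zero is excluded because the
  values become entries of vectors with full support.\<close>

lemma countable_dense_nonzero:
  obtains D :: "nat \<Rightarrow> 'a::real_normed_field"
  where "\<And>n. D n \<noteq> 0" "\<And>x \<epsilon>. \<epsilon> > 0 \<Longrightarrow> \<exists>n. norm (D n - x) < \<epsilon>"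
proof -
  obtain b :: 'a where b: "\<And>z::'a. \<exists>s t :: real. z = of_real s + of_real t * b"
    using real_normed_field_two_dimensional by blast
  define g where "g = (\<lambda>q::rat \<times> rat. of_real (of_rat (fst q)) + of_real (of_rat (snd q)) * b)"
  have g_dense: "\<exists>q. norm (g q - x) < \<epsilon>" if "\<epsilon> > 0" for x \<epsilon>
  proof -
    obtain s t :: real where x: "x = of_real s + of_real t * b" using b by blast
    \<comment> \<open>Errors below \<open>d\<close> in both coordinates cost at most
      \<open>d * (1 + norm b)\<close>; the 2 makes this strictly less than
      \<open>\<epsilon>\<close>.\<close>
    define d where "d = \<epsilon> / (2 + norm b)"
    have d: "d > 0" "d * (2 + norm b) = \<epsilon>"
      using that by (auto simp: d_def add_pos_nonneg less_imp_neq[symmetric])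
    obtain q r where q: "s < of_rat q" "of_rat q < s + d" and r: "t < of_rat r" "of_rat r < t + d"
      using of_rat_dense[of s "s + d"] of_rat_dense[of t "t + d"] d(1) by auto
    have "g (q, r) - x = of_real (of_rat q - s) + of_real (of_rat r - t) * b"
      by (simp add: g_def x algebra_simps)
    also have "norm \<dots> \<le> \<bar>of_rat q - s\<bar> + \<bar>of_rat r - t\<bar> * norm b"
      by (rule order.trans[OF norm_triangle_ineq]) (simp only: norm_mult norm_of_real order_refl)
    also have "\<dots> \<le> d + d * norm b"
      using q r by (intro add_mono mult_right_mono) auto
    also have "\<dots> < \<epsilon>" using d by (simp add: algebra_simps)
    finally show ?thesis by blast
  qed
  define D where "D = (\<lambda>n. let y = g (from_nat n) in if y = 0 then 1 else y)"
  have "\<exists>n. norm (D n - x) < \<epsilon>" if "\<epsilon> > 0" for x \<epsilon>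
  proof -
    \<comment> \<open>A zero target is first moved to a nonzero \<open>x'\<close>; an approximation
      closer to \<open>x'\<close> than \<open>norm x'\<close> is nonzero and so is left alone by
      \<open>D\<close>.\<close>
    define x' where "x' = (if x = 0 then of_real (\<epsilon> / 2) else x)"
    have x': "x' \<noteq> 0" "norm (x' - x) \<le> \<epsilon> / 2"
      using that by (auto simp: x'_def simp del: of_real_divide)
    have "min (\<epsilon> / 2) (norm x') > 0" using that x'(1) by simp
    then obtain q where q: "norm (g q - x') < min (\<epsilon> / 2) (norm x')"
      using g_dense by blast
    then have "g q \<noteq> 0" by auto
    moreover have "norm (g q - x) < \<epsilon>"
      using norm_triangle_ineq[of "g q - x'" "x' - x"] q x'(2) by simp
    ultimately show ?thesis by (intro exI[of _ "to_nat q"]) (simp add: D_def)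
  qed
  moreover have "D n \<noteq> 0" for n by (simp add: D_def Let_def)
  ultimately show ?thesis using that by blast
qed

subsection \<open>The sequence space\<close>

text \<open>For positive \<open>a\<close> and \<open>b\<close> this is convexity of the power
  function; if one of them is 0, it reduces to \<open>t powr p \<le> t\<close> on the unit
  interval.\<close>

lemma powr_convex_combination:
  fixes a b u v p :: real
  assumes "1 \<le> p" "0 \<le> a" "0 \<le> b" "0 \<le> u" "0 \<le> v" "u + v = 1"
  shows "(u * a + v * b) powr p \<le> u * a powr p + v * b powr p"
proof -
  have shrink: "(t * c) powr p \<le> t * c powr p" if "0 \<le> t" "t \<le> 1" "0 \<le> c" for t c :: real
  proof (cases "t = 0")
    case False
    then have "t powr p \<le> t powr 1" using that assms(1) by (intro powr_mono') auto
    then show ?thesis using that False by (simp add: powr_mult mult_right_mono)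
  qed simp
  consider "a = 0" | "b = 0" | "a > 0" "b > 0" using assms by fastforce
  then show ?thesis
  proof cases
    case 3
    have "((1 - v) * a + v * b) powr p \<le> (1 - v) * a powr p + v * b powr p"
      using convex_onD[OF powr_convex[OF assms(1)], of v a b] 3 assms by simp
    moreover have "u = 1 - v" using assms by simp
    ultimately show ?thesis by simp
  qed (use assms shrink[of v b] shrink[of u a] in auto)
qed

lemma lpI: "x 0 = 0 \<Longrightarrow> summable (\<lambda>m. norm (x m) powr p) \<Longrightarrow> x \<in> lp p"
  by (simp add: lp_def)

lemma lp_norm_nonneg [simp]: "0 \<le> lp_norm p x"
  by (simp add: lp_norm_def)

context
  fixes p :: real
  assumes p: "1 \<le> p"
begin

lemma lp_norm_powr:
  assumes "x \<in> lp p"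
  shows "lp_norm p x powr p = (\<Sum>m. norm (x m) powr p)"
  using p assms by (simp add: lp_norm_def powr_powr suminf_nonneg lp_def)

lemma lp_norm_le_iff:
  assumes "x \<in> lp p" "0 \<le> B"
  shows "lp_norm p x \<le> B \<longleftrightarrow> (\<Sum>m. norm (x m) powr p) \<le> B powr p"
proof
  assume "lp_norm p x \<le> B"
  then show "(\<Sum>m. norm (x m) powr p) \<le> B powr p"
    unfolding lp_norm_powr[OF assms(1), symmetric] using p by (intro powr_mono2) auto
next
  assume "(\<Sum>m. norm (x m) powr p) \<le> B powr p"
  then have "lp_norm p x powr p \<le> B powr p"
    unfolding lp_norm_powr[OF assms(1)] .
  then show "lp_norm p x \<le> B"
    using powr_less_mono2[of p B "lp_norm p x"] p assms(2) by force
qed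

text \<open>Bounds on partial sums give membership and the norm estimate together, which reduces
  later estimates to finite sums.\<close>

lemma lp_finite_bound:
  assumes "x 0 = 0" "0 \<le> B" "\<And>n. (\<Sum>m<n. norm (x m) powr p) \<le> B powr p"
  shows "x \<in> lp p" "lp_norm p x \<le> B"
proof -
  have s: "summable (\<lambda>m. norm (x m) powr p)"
    by (rule summableI_nonneg_bounded[OF _ assms(3)]) auto
  then show l: "x \<in> lp p" using assms(1) by (intro lpI)
  have "(\<Sum>m. norm (x m) powr p) \<le> B powr p"
    by (rule suminf_le_const[OF s assms(3)])
  then show "lp_norm p x \<le> B" using lp_norm_le_iff[OF l assms(2)] by simp
qed

lemma lp_sum_le:
  assumes "x \<in> lp p" "lp_norm p x \<le> B" "finite F"
  shows "(\<Sum>m\<in>F. norm (x m) powr p) \<le> B powr p"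
proof -
  have "0 \<le> B" using assms(2) lp_norm_nonneg order.trans by blast
  have "(\<Sum>m\<in>F. norm (x m) powr p) \<le> (\<Sum>m. norm (x m) powr p)"
    using assms by (intro sum_le_suminf) (auto simp: lp_def)
  also have "\<dots> \<le> B powr p" using lp_norm_le_iff[OF assms(1) \<open>0 \<le> B\<close>] assms(2) by simp
  finally show ?thesis .
qed

lemma norm_le_lp_norm:
  assumes "x \<in> lp p"
  shows "norm (x m) \<le> lp_norm p x"
proof -
  have "norm (x m) powr p \<le> lp_norm p x powr p"
    using lp_sum_le[OF assms order_refl, of "{m}"] by simp
  then show ?thesis
    using powr_less_mono2[of p "lp_norm p x" "norm (x m)"] p by force
qed

lemma lp_add:
  assumes "x \<in> lp p" "y \<in> lp p"
  shows "(\<lambda>m. x m + y m) \<in> lp p" "lp_norm p (\<lambda>m. x m + y m) \<le> lp_norm p x + lp_norm p y"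
proof -
  \<comment> \<open>Minkowski's inequality from convexity, after scaling both vectors. Positive
    upper bounds \<open>s\<close>, \<open>t\<close> replace the norms so that nothing is divided by
    0; they are brought down to the norms at the end.\<close>
  have main: "(\<lambda>m. x m + y m) \<in> lp p \<and> lp_norm p (\<lambda>m. x m + y m) \<le> s + t"
    if s: "lp_norm p x \<le> s" "0 < s" and t: "lp_norm p y \<le> t" "0 < t" for s t
  proof -
    define u v where "u = s / (s + t)" and "v = t / (s + t)"
    have "s + t \<noteq> 0" using s t by simp
    then have uv: "0 \<le> u" "0 \<le> v" "u + v = 1" "(s + t) * u = s" "(s + t) * v = t"
      using s t by (simp_all add: u_def v_def flip: add_divide_distrib)
    have step: "norm (x m + y m) powr p
        \<le> (s + t) powr p * (u * (norm (x m) powr p / s powr p) + v * (norm (y m) powr p / t powr p))" for m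
    proof -
      have "norm (x m + y m) \<le> norm (x m) + norm (y m)" by (rule norm_triangle_ineq)
      also have "\<dots> = (s + t) * (u * (norm (x m) / s) + v * (norm (y m) / t))"
        using uv s t by (simp add: distrib_left mult.assoc[symmetric])
      finally have "norm (x m + y m) powr p \<le> ((s + t) * (u * (norm (x m) / s) + v * (norm (y m) / t))) powr p"
        using p by (intro powr_mono2) auto
      also have "\<dots> = (s + t) powr p * (u * (norm (x m) / s) + v * (norm (y m) / t)) powr p"
        using s t uv by (intro powr_mult)
      also have "\<dots> \<le> (s + t) powr p * (u * (norm (x m) / s) powr p + v * (norm (y m) / t) powr p)"
        using p uv s t by (intro mult_left_mono powr_convex_combination) auto
      finally show ?thesis using s t by (simp add: powr_divide)
    qed
    have "(\<Sum>m<n. norm (x m + y m) powr p) \<le> (s + t) powr p" for n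
    proof -
      have "(\<Sum>m<n. norm (x m + y m) powr p)
        \<le> (\<Sum>m<n. (s + t) powr p * (u * (norm (x m) powr p / s powr p) + v * (norm (y m) powr p / t powr p)))"
        by (intro sum_mono step)
      also have "\<dots> = (s + t) powr p * (u * ((\<Sum>m<n. norm (x m) powr p) / s powr p)
          + v * ((\<Sum>m<n. norm (y m) powr p) / t powr p))"
        by (simp only: sum_distrib_left sum_divide_distrib sum.distrib[symmetric])
      also have "\<dots> \<le> (s + t) powr p * (u * 1 + v * 1)"
        using lp_sum_le[OF assms(1) s(1), of "{..<n}"] lp_sum_le[OF assms(2) t(1), of "{..<n}"] s t uv
        by (intro mult_left_mono add_mono) auto
      finally show ?thesis using uv by simp
    qed
    moreover have "x 0 + y 0 = 0" using assms by (simp add: lp_def)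
    ultimately show ?thesis
      using lp_finite_bound[of "\<lambda>m. x m + y m" "s + t"] s t by simp
  qed
  show "(\<lambda>m. x m + y m) \<in> lp p"
    using main[of "lp_norm p x + 1" "lp_norm p y + 1"] by (simp add: add_nonneg_pos)
  show "lp_norm p (\<lambda>m. x m + y m) \<le> lp_norm p x + lp_norm p y"
  proof (rule field_le_epsilon)
    fix e :: real assume "e > 0"
    then show "lp_norm p (\<lambda>m. x m + y m) \<le> lp_norm p x + lp_norm p y + e"
      using main[of "lp_norm p x + e / 2" "lp_norm p y + e / 2"] by (simp add: add_nonneg_pos)
  qed
qed

lemma lp_minus:
  assumes "x \<in> lp p"
  shows "(\<lambda>m. - x m) \<in> lp p" "lp_norm p (\<lambda>m. - x m) = lp_norm p x"
  using assms by (auto simp: lp_def lp_norm_def)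

lemma lp_diff:
  assumes "x \<in> lp p" "y \<in> lp p"
  shows "x - y \<in> lp p"
  using lp_add(1)[OF assms(1) lp_minus(1)[OF assms(2)]] by (simp add: fun_diff_def)

lemma lp_norm_triangle:
  assumes "x \<in> lp p" "y \<in> lp p" "z \<in> lp p"
  shows "lp_norm p (x - z) \<le> lp_norm p (x - y) + lp_norm p (y - z)"
  using lp_add(2)[OF lp_diff[OF assms(1,2)] lp_diff[OF assms(2,3)]] by (simp add: fun_diff_def)

lemma lp_norm_le_diff:
  assumes "x \<in> lp p" "y \<in> lp p"
  shows "lp_norm p x \<le> lp_norm p (x - y) + lp_norm p y"
  using lp_add(2)[OF lp_diff[OF assms] assms(2)] by simp

text \<open>The sum of powers is at most \<open>card F * \<delta> powr p\<close>, and
  \<open>card F \<le> card F powr p\<close> for nonempty \<open>F\<close> because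
  \<open>1 \<le> p\<close>.\<close>

lemma lp_finite_support:
  assumes "x 0 = 0" "finite F" "\<And>m. m \<notin> F \<Longrightarrow> x m = 0" "\<And>m. norm (x m) \<le> \<delta>"
  shows "x \<in> lp p" "lp_norm p x \<le> of_nat (card F) * \<delta>"
proof -
  have \<delta>: "0 \<le> \<delta>" using assms(4)[of 0] norm_ge_zero order.trans by blast
  have "(\<Sum>m<n. norm (x m) powr p) \<le> (of_nat (card F) * \<delta>) powr p" for n
  proof (cases "F = {}")
    case False
    then have c: "1 \<le> real (card F)" using assms(2) by (simp add: Suc_le_eq card_gt_0_iff)
    have "(\<Sum>m<n. norm (x m) powr p) = (\<Sum>m\<in>{..<n} \<inter> F. norm (x m) powr p)"
      using assms(3) by (intro sum.mono_neutral_right) auto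
    also have "\<dots> \<le> (\<Sum>m\<in>F. norm (x m) powr p)"
      using assms(2) by (intro sum_mono2) auto
    also have "\<dots> \<le> of_nat (card F) * \<delta> powr p"
      using p assms(4) by (intro sum_bounded_above powr_mono2) auto
    also have "\<dots> \<le> of_nat (card F) powr p * \<delta> powr p"
      using c p powr_mono[of 1 p "real (card F)"] by (intro mult_right_mono) auto
    also have "\<dots> = (of_nat (card F) * \<delta>) powr p" using \<delta> by (simp add: powr_mult)
    finally show ?thesis .
  qed (use assms in auto)
  then show "x \<in> lp p" "lp_norm p x \<le> of_nat (card F) * \<delta>"
    using lp_finite_bound[of x "of_nat (card F) * \<delta>"] assms(1) \<delta> by auto
qed

text \<open>Estimates of partial sums pass to coordinatewise limits. This takes the place of
  completeness of \<open>lp p\<close>: it puts the universal vector into the space and carries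
  estimates from its approximations over to it.\<close>

lemma lp_fatou:
  assumes "\<And>j. z j \<in> lp p" "\<forall>\<^sub>F j in sequentially. lp_norm p (z j) \<le> B"
    and "\<And>m. (\<lambda>j. z j m) \<longlonglongrightarrow> x m"
  shows "x \<in> lp p" "lp_norm p x \<le> B"
proof -
  have "x 0 = 0"
    using assms(1) assms(3)[of 0] by (simp add: lp_def LIMSEQ_const_iff)
  have B: "0 \<le> B"
  proof -
    obtain j where "lp_norm p (z j) \<le> B"
      using eventually_happens'[OF _ assms(2)] by auto
    then show ?thesis using lp_norm_nonneg order.trans by blast
  qed
  have "(\<Sum>m<n. norm (x m) powr p) \<le> B powr p" for n
  proof (rule tendsto_upperbound)
    show "(\<lambda>j. \<Sum>m<n. norm (z j m) powr p) \<longlonglongrightarrow> (\<Sum>m<n. norm (x m) powr p)"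
      using p by (intro tendsto_sum tendsto_powr' tendsto_norm assms(3) tendsto_const) auto
    show "\<forall>\<^sub>F j in sequentially. (\<Sum>m<n. norm (z j m) powr p) \<le> B powr p"
      using assms(2) by eventually_elim (auto intro!: lp_sum_le assms(1))
  qed simp
  then show "x \<in> lp p" "lp_norm p x \<le> B"
    using lp_finite_bound[of x B] \<open>x 0 = 0\<close> B by auto
qed

lemma lp_coord_tendsto_0:
  assumes "x \<in> lp p"
  shows "x \<longlonglongrightarrow> 0"
proof -
  have "(\<lambda>m. norm (x m) powr p) \<longlonglongrightarrow> 0"
    using assms by (simp add: lp_def summable_LIMSEQ_zero)
  then have "(\<lambda>m. (norm (x m) powr p) powr (1 / p)) \<longlonglongrightarrow> 0 powr (1 / p)"
    using p by (intro tendsto_powr' tendsto_const) auto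
  then show ?thesis using p by (simp add: powr_powr tendsto_norm_zero_iff)
qed

lemma lp_truncation:
  assumes "x \<in> lp p" "\<epsilon> > 0"
  shows "\<forall>\<^sub>F M in sequentially. lp_norm p ((\<lambda>m. if m \<le> M then x m else 0) - x) \<le> \<epsilon>"
proof -
  have s: "summable (\<lambda>m. norm (x m) powr p)" using assms(1) by (simp add: lp_def)
  obtain M0 where M0: "\<And>n. n \<ge> M0 \<Longrightarrow> norm (\<Sum>m. norm (x (m + n)) powr p) < \<epsilon> powr p"
    using suminf_exist_split[OF _ s] assms(2) by (metis powr_gt_zero less_irrefl)
  have "lp_norm p ((\<lambda>m. if m \<le> M then x m else 0) - x) \<le> \<epsilon>" if "M \<ge> M0" for M
  proof (rule lp_finite_bound)
    fix n
    let ?y = "(\<lambda>m. if m \<le> M then x m else 0) - x"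
    have "(\<Sum>m<n. norm (?y m) powr p) \<le> (\<Sum>m<n + Suc M. norm (?y m) powr p)"
      by (intro sum_mono2) auto
    also have "\<dots> = (\<Sum>m<n. norm (?y (m + Suc M)) powr p)"
    proof -
      have "(\<Sum>m<Suc M. norm (?y m) powr p) = 0" by (intro sum.neutral) auto
      then show ?thesis
        using sum.atLeastLessThan_concat[of 0 "Suc M" "n + Suc M" "\<lambda>m. norm (?y m) powr p"]
          sum.shift_bounds_nat_ivl[of "\<lambda>m. norm (?y m) powr p" 0 "Suc M" n]
        by (simp add: atLeast0LessThan)
    qed
    also have "\<dots> = (\<Sum>m<n. norm (x (m + Suc M)) powr p)" by simp
    also have "\<dots> \<le> (\<Sum>m. norm (x (m + Suc M)) powr p)"
      using summable_ignore_initial_segment[OF s, of "Suc M"] by (intro sum_le_suminf) auto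
    also have "\<dots> \<le> \<epsilon> powr p" using M0[of "Suc M"] that by simp
    finally show "(\<Sum>m<n. norm (?y m) powr p) \<le> \<epsilon> powr p" .
  qed (use assms in \<open>auto simp: lp_def\<close>)
  then show ?thesis by (auto simp: eventually_sequentially)
qed

end

section \<open>Vectors supported exactly on an initial segment, and a countable dense family of
  them\<close>

lemma finite_positive_lower_bound:
  fixes g :: "'a \<Rightarrow> real"
  assumes "finite A" "\<And>a. a \<in> A \<Longrightarrow> 0 < g a"
  obtains d where "0 < d" "\<And>a. a \<in> A \<Longrightarrow> d \<le> g a"
proof
  show "0 < Min (insert 1 (g ` A))" using assms by (subst Min_gr_iff) auto
  show "Min (insert 1 (g ` A)) \<le> g a" if "a \<in> A" for a
    using assms(1) that by (intro Min_le) auto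
qed

text \<open>Entries are nonzero throughout \<open>{1..M}\<close> because they serve as the scalars
  of the ratio condition, where they occur in denominators.\<close>

definition full_support :: "nat \<Rightarrow> (nat \<Rightarrow> 'k::zero) \<Rightarrow> bool" where
  "full_support M x \<longleftrightarrow> M \<ge> 1 \<and> (\<forall>m. x m \<noteq> 0 \<longleftrightarrow> m \<in> {1..M})"

lemma full_supportD:
  assumes "full_support M x"
  shows "1 \<le> M" "x 0 = 0" "\<And>m. m \<in> {1..M} \<Longrightarrow> x m \<noteq> 0" "\<And>m. m \<notin> {1..M} \<Longrightarrow> x m = 0"
  using assms by (auto simp: full_support_def)

lemma full_support_bounded:
  fixes x :: "nat \<Rightarrow> 'k::real_normed_vector"
  assumes "full_support M x"
  obtains B where "0 < B" "\<And>m. norm (x m) \<le> B"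
proof
  show "0 < (\<Sum>m\<in>{1..M}. norm (x m)) + 1" by (simp add: sum_nonneg add_nonneg_pos)
  show "norm (x m) \<le> (\<Sum>m\<in>{1..M}. norm (x m)) + 1" for m
  proof (cases "m \<in> {1..M}")
    case True
    then have "norm (x m) \<le> (\<Sum>m\<in>{1..M}. norm (x m))" by (intro member_le_sum) auto
    then show ?thesis by simp
  next
    case False
    then show ?thesis using full_supportD(4)[OF assms] by (simp add: sum_nonneg add_nonneg_nonneg)
  qed
qed

lemma full_support_lp:
  fixes x :: "nat \<Rightarrow> 'k::real_normed_vector"
  assumes "1 \<le> p" "full_support M x"
  shows "x \<in> lp p"
proof -
  obtain B where "\<And>m. norm (x m) \<le> B" using full_support_bounded[OF assms(2)] by metis
  then show ?thesis
    using lp_finite_support(1)[OF assms(1), of x "{1..M}" B] full_supportD[OF assms(2)] by auto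
qed

text \<open>A vector is coded by a list of indices into a dense sequence of nonzero scalars together
  with a dummy number. The dummy makes each list recur at arbitrarily large \<open>n\<close>, hence
  \<open>n \<ge> K\<close>.\<close>

lemma countable_dense_full_support:
  obtains V :: "nat \<Rightarrow> nat \<Rightarrow> 'k::real_normed_field"
  where "\<And>n. \<exists>M. full_support M (V n)"
    "\<And>M x \<epsilon> K. full_support M x \<Longrightarrow> \<epsilon> > 0 \<Longrightarrow>
       \<exists>n\<ge>K. full_support M (V n) \<and> (\<forall>m. norm (V n m - x m) < \<epsilon>)"
proof -
  obtain D :: "nat \<Rightarrow> 'k" where D: "\<And>n. D n \<noteq> 0" "\<And>x \<epsilon>. \<epsilon> > 0 \<Longrightarrow> \<exists>n. norm (D n - x) < \<epsilon>"
    using countable_dense_nonzero by metis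
  define vec where "vec = (\<lambda>L m. if m \<in> {1..length L} then D (L ! (m - 1)) else 0)"
  \<comment> \<open>The empty list would code the zero vector, which does not have full
    support.\<close>
  define nonempty where "nonempty = (\<lambda>L::nat list. if L = [] then [0] else L)"
  define V where "V = (\<lambda>n. vec (nonempty (snd (from_nat n :: nat \<times> nat list))))"
  have vec: "full_support (length L) (vec L)" if "L \<noteq> []" for L
    using that D(1) by (simp add: full_support_def vec_def Suc_le_eq)
  have "\<exists>n\<ge>K. full_support M (V n) \<and> (\<forall>m. norm (V n m - x m) < \<epsilon>)"
    if x: "full_support M x" and "\<epsilon> > 0" for M x \<epsilon> K
  proof -
    have "\<forall>m. \<exists>k. norm (D k - x m) < \<epsilon>" using D(2)[OF \<open>\<epsilon> > 0\<close>] by blast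
    then obtain g where g: "\<And>m. norm (D (g m) - x m) < \<epsilon>" by metis
    define L where "L = map (\<lambda>i. g (Suc i)) [0..<M]"
    have L: "length L = M" "L \<noteq> []" using full_supportD(1)[OF x] by (auto simp: L_def)
    have "infinite ((\<lambda>s::nat. to_nat (s, L)) ` UNIV)"
      by (intro range_inj_infinite injI) simp
    then obtain s :: nat where s: "to_nat (s, L) \<ge> K"
      unfolding infinite_nat_iff_unbounded_le by auto
    have V: "V (to_nat (s, L)) = vec L" by (simp add: V_def nonempty_def L)
    have "norm (vec L m - x m) < \<epsilon>" for m
    proof (cases "m \<in> {1..M}")
      case True
      then have "vec L m = D (g m)" by (cases m) (auto simp: vec_def L_def)
      then show ?thesis using g by simp
    next
      case False
      then have "vec L m = 0" "x m = 0" using L full_supportD(4)[OF x] by (auto simp: vec_def)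
      then show ?thesis using \<open>\<epsilon> > 0\<close> by simp
    qed
    then show ?thesis using s vec[OF L(2)] L(1) V by (intro exI[of _ "to_nat (s, L)"]) auto
  qed
  moreover have "\<exists>M. full_support M (V n)" for n
    unfolding V_def by (rule exI, rule vec) (simp add: nonempty_def)
  ultimately show ?thesis using that by blast
qed

lemma full_support_dense:
  fixes y :: "nat \<Rightarrow> 'k::real_normed_field"
  assumes "1 \<le> p" "y \<in> lp p" "\<epsilon> > 0"
  obtains M x where "full_support M x" "lp_norm p (x - y) < \<epsilon>"
proof -
  have "\<forall>\<^sub>F M in sequentially. lp_norm p ((\<lambda>m. if m \<le> M then y m else 0) - y) \<le> \<epsilon> / 2 \<and> M \<ge> 1"
    using lp_truncation[OF assms(1,2), of "\<epsilon> / 2"] assms(3) by (intro eventually_conj eventually_ge_at_top) auto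
  then obtain M where M: "M \<ge> 1" "lp_norm p ((\<lambda>m. if m \<le> M then y m else 0) - y) \<le> \<epsilon> / 2"
    using eventually_happens by fastforce
  define t where "t = (\<lambda>m. if m \<le> M then y m else 0)"
  \<comment> \<open>Zeros inside \<open>{1..M}\<close> are filled with \<open>\<delta>\<close>. At
    most \<open>M\<close> coordinates change, which costs at most \<open>\<epsilon> / 4\<close> on
    top of \<open>\<epsilon> / 2\<close> for the truncation.\<close>
  define \<delta> where "\<delta> = \<epsilon> / (4 * M)"
  have \<delta>: "\<delta> > 0" "M * \<delta> = \<epsilon> / 4" using assms(3) M(1) by (auto simp: \<delta>_def)
  define x where "x = (\<lambda>m. if m \<in> {1..M} then if y m = 0 then of_real \<delta> else y m else 0)"
  have x: "full_support M x" using M(1) \<delta>(1) by (auto simp: full_support_def x_def)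
  have y0: "y 0 = 0" using assms(2) by (simp add: lp_def)
  have diff: "norm ((x - t) m) \<le> \<delta>" "m \<notin> {1..M} \<Longrightarrow> (x - t) m = 0" for m
    using \<delta>(1) y0 by (cases m; auto simp: x_def t_def)+
  have xt: "x - t \<in> lp p" "lp_norm p (x - t) \<le> M * \<delta>"
    using lp_finite_support[OF assms(1), of "x - t" "{1..M}" \<delta>] diff(2)[of 0] diff by auto
  have "x \<in> lp p" by (rule full_support_lp[OF assms(1) x])
  moreover from lp_diff[OF assms(1) this xt(1)] have "t \<in> lp p" by (simp add: fun_diff_def)
  ultimately have "lp_norm p (x - y) \<le> lp_norm p (x - t) + lp_norm p (t - y)"
    using assms by (intro lp_norm_triangle) auto
  then have "lp_norm p (x - y) < \<epsilon>" using xt(2) M(2) \<delta> assms(3) unfolding t_def by simp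
  then show ?thesis using x that by blast
qed

section \<open>A single pseudo-shift: iterates and boundedness\<close>

context
  fixes f :: "nat \<Rightarrow> nat" and w :: "nat \<Rightarrow> 'k::real_normed_field"
  assumes data: "pseudo_shift_data f w"
begin

text \<open>Strict monotonicity and \<open>f 1 > 1\<close> force \<open>f m \<ge> m + 1\<close>. By
  this drift, iterates annihilate finitely supported vectors, and the coordinates read at time
  \<open>n\<close> lie beyond \<open>n\<close>, where the entries of an \<open>lp\<close> vector are
  small.\<close>

lemma shift_map_ge: "m \<ge> 1 \<Longrightarrow> m + n \<le> (f ^^ n) m"
proof (induction n)
  case (Suc n)
  have "Suc m \<le> f m" if "m \<ge> 1" for m
    using that
  proof (induction m rule: dec_induct)
    case (step m)
    have "f m < f (Suc m)"
      using data step.hyps by (auto simp: pseudo_shift_data_def intro: strict_mono_onD)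
    then show ?case using step.IH by simp
  qed (use data in \<open>simp add: pseudo_shift_data_def\<close>)
  from this[of "(f ^^ n) m"] show ?case using Suc by simp
qed simp

lemma shift_map_ge_1: "m \<ge> 1 \<Longrightarrow> (f ^^ n) m \<ge> 1"
  using shift_map_ge[of m n] by simp

lemma inj_shift_map: "inj_on (f ^^ n) {1..}"
proof (induction n)
  case (Suc n)
  have "inj_on f {1..}"
    using data by (auto simp: pseudo_shift_data_def intro: strict_mono_on_imp_inj_on)
  then have "inj_on f ((f ^^ n) ` {1..})"
    by (rule inj_on_subset) (use shift_map_ge_1 in auto)
  then show ?case using comp_inj_on[OF Suc] by (simp only: funpow.simps)
qed simp

lemma finv_shift_map: "m \<ge> 1 \<Longrightarrow> finv f n ((f ^^ n) m) = m"
  unfolding finv_def by (intro the_inv_into_f_f inj_shift_map) auto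

lemma Wprod_Suc: "Wprod f w m (Suc n) = w (f m) * Wprod f w (f m) n"
  unfolding Wprod_def One_nat_def prod.atLeast1_atMost_eq
  by (simp only: prod.lessThan_Suc_shift) (simp add: funpow_swap1)

lemma Wprod_nonzero: "m \<ge> 1 \<Longrightarrow> Wprod f w m n \<noteq> 0"
proof (induction n arbitrary: m)
  case (Suc n)
  have "w (f m) \<noteq> 0" using data Suc.prems by (simp add: pseudo_shift_data_def)
  moreover have "f m \<ge> 1" using shift_map_ge_1[OF Suc.prems, of 1] by simp
  ultimately show ?case using Suc.IH by (simp add: Wprod_Suc)
qed (simp add: Wprod_def)

lemma pseudo_shift_funpow:
  "x 0 = 0 \<Longrightarrow> (pseudo_shift f w ^^ n) x = (\<lambda>m. if m = 0 then 0 else Wprod f w m n * x ((f ^^ n) m))"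
proof (induction n)
  case (Suc n)
  have f: "f m > 0" if "m > 0" for m using shift_map_ge_1[of m 1] that by simp
  have step: "(pseudo_shift f w ^^ Suc n) x
      = pseudo_shift f w (\<lambda>m. if m = 0 then 0 else Wprod f w m n * x ((f ^^ n) m))"
    using Suc by simp
  show ?case
  proof
    fix m
    show "(pseudo_shift f w ^^ Suc n) x m = (if m = 0 then 0 else Wprod f w m (Suc n) * x ((f ^^ Suc n) m))"
      unfolding step using f[of m]
      by (cases "m = 0") (simp_all add: pseudo_shift_def Wprod_Suc funpow_swap1)
  qed
qed (auto simp: Wprod_def)

lemma pseudo_shift_funpow_diff:
  assumes "x 0 = 0" "y 0 = 0"
  shows "(pseudo_shift f w ^^ n) (x - y) = (pseudo_shift f w ^^ n) x - (pseudo_shift f w ^^ n) y"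
  using assms by (simp add: pseudo_shift_funpow fun_eq_iff right_diff_distrib)

text \<open>\<open>f\<close> is injective, so each coordinate of \<open>x\<close> is read at most
  once, and the bound on the weights becomes a bound on the operator.\<close>

lemma pseudo_shift_bounded:
  assumes p: "1 \<le> p"
  obtains C where "C \<ge> 1"
    "\<And>x. x \<in> lp p \<Longrightarrow> pseudo_shift f w x \<in> lp p \<and> lp_norm p (pseudo_shift f w x) \<le> C * lp_norm p x"
proof -
  obtain C0 where C0: "\<And>m. m \<ge> 1 \<Longrightarrow> norm (w (f m)) \<le> C0"
    using data by (force simp: pseudo_shift_data_def bounded_iff)
  define C where "C = max 1 C0"
  have C: "C \<ge> 1" "\<And>m. m \<ge> 1 \<Longrightarrow> norm (w (f m)) \<le> C"
    using C0 by (auto simp: C_def le_max_iff_disj)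
  have "pseudo_shift f w x \<in> lp p \<and> lp_norm p (pseudo_shift f w x) \<le> C * lp_norm p x"
    if x: "x \<in> lp p" for x
  proof -
    have "(\<Sum>m<n. norm (pseudo_shift f w x m) powr p) \<le> (C * lp_norm p x) powr p" for n
    proof -
      have "(\<Sum>m<n. norm (pseudo_shift f w x m) powr p)
          = (\<Sum>m\<in>{1..<n}. norm (w (f m) * x (f m)) powr p)"
        by (intro sum.mono_neutral_cong_right) (auto simp: pseudo_shift_def)
      also have "\<dots> \<le> (\<Sum>m\<in>{1..<n}. C powr p * norm (x (f m)) powr p)"
      proof (rule sum_mono)
        fix m assume "m \<in> {1..<n}"
        then have "norm (w (f m) * x (f m)) \<le> C * norm (x (f m))"
          using C(2) by (simp add: norm_mult mult_right_mono)
        then have "norm (w (f m) * x (f m)) powr p \<le> (C * norm (x (f m))) powr p"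
          using p by (intro powr_mono2) auto
        then show "norm (w (f m) * x (f m)) powr p \<le> C powr p * norm (x (f m)) powr p"
          using C(1) by (simp add: powr_mult)
      qed
      also have "\<dots> = C powr p * (\<Sum>j\<in>f ` {1..<n}. norm (x j) powr p)"
        using inj_shift_map[of 1]
        by (subst sum.reindex) (auto simp: sum_distrib_left intro: inj_on_subset)
      also have "\<dots> \<le> C powr p * lp_norm p x powr p"
        by (intro mult_left_mono lp_sum_le[OF p x]) auto
      also have "\<dots> = (C * lp_norm p x) powr p" using C(1) by (simp add: powr_mult)
      finally show ?thesis .
    qed
    moreover have "pseudo_shift f w x 0 = 0" by (simp add: pseudo_shift_def)
    ultimately show ?thesis
      using lp_finite_bound[OF p, of "pseudo_shift f w x" "C * lp_norm p x"] C(1) by simp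
  qed
  then show ?thesis using that C(1) by blast
qed

end

subsection \<open>Families of pseudo-shifts\<close>

text \<open>Common positions are described by their preimages \<open>m\<close> and \<open>m'\<close>
  instead of by \<open>j\<close>, which removes \<open>finv\<close>; as \<open>m\<close> ranges over
  all positive indices, preimages inside and outside \<open>{1..M}\<close> are treated
  alike.\<close>

definition ratio_close ::
  "nat \<Rightarrow> (nat \<Rightarrow> nat \<Rightarrow> nat) \<Rightarrow> (nat \<Rightarrow> nat \<Rightarrow> 'k::real_normed_field) \<Rightarrow> nat \<Rightarrow> real \<Rightarrow> nat \<Rightarrow> (nat \<Rightarrow> 'k) \<Rightarrow> bool" where
  "ratio_close N f w n \<epsilon> M b \<longleftrightarrow> (\<forall>i\<in>{1..N}. \<forall>l\<in>{1..N}. i \<noteq> l \<longrightarrow>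
     (\<forall>m\<ge>1. \<forall>m'\<in>{1..M}. (f i ^^ n) m = (f l ^^ n) m' \<longrightarrow>
        norm (Wprod (f i) (w i) m n / Wprod (f l) (w l) m' n - b m / b m') < \<epsilon>))"

locale pseudo_shift_family =
  fixes p :: real and N :: nat
    and f :: "nat \<Rightarrow> nat \<Rightarrow> nat"
    and w :: "nat \<Rightarrow> nat \<Rightarrow> 'k::{real_normed_field, banach}"
  assumes p: "1 \<le> p"
    and data: "\<And>i. i \<in> {1..N} \<Longrightarrow> pseudo_shift_data (f i) (w i)"
begin

abbreviation "T i \<equiv> pseudo_shift (f i) (w i)"
abbreviation "W i \<equiv> Wprod (f i) (w i)"
abbreviation "F i n \<equiv> (f i ^^ n)"

text \<open>Setting \<open>a\<close> to zero outside \<open>[M]\<close> turns the two inequalities of condition (b) into the single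
  one of \<open>ratio_close\<close>.\<close>

lemma ratio_close_iff:
  assumes a: "\<forall>m\<in>{1..M}. a m \<noteq> 0" and b: "b = (\<lambda>m. if m \<in> {1..M} then a m else 0)"
  shows "ratio_close N f w n \<epsilon> M b \<longleftrightarrow>
    (\<forall>i\<in>{1..N}. \<forall>l\<in>{1..N}. i \<noteq> l \<longrightarrow>
              (\<forall>j \<in> F l n ` {1..M} \<inter> F i n ` ({1..} - {1..M}).
                 norm (W i (finv (f i) n j) n / W l (finv (f l) n j) n) < \<epsilon>) \<and>
              (\<forall>j \<in> F l n ` {1..M} \<inter> F i n ` {1..M}.
                 norm (W i (finv (f i) n j) n / W l (finv (f l) n j) n
                       - a (finv (f i) n j) / a (finv (f l) n j)) < \<epsilon>))"
    (is "?L \<longleftrightarrow> ?R")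
proof
  have finv: "finv (f i) n (F i n m) = m" if "i \<in> {1..N}" "m \<ge> 1" for i m
    using finv_shift_map[OF data[OF that(1)] that(2)] .
  show ?R if L: ?L
  proof (intro ballI impI conjI)
    fix i l j assume il: "i \<in> {1..N}" "l \<in> {1..N}" "i \<noteq> l"
      and "j \<in> F l n ` {1..M} \<inter> F i n ` ({1..} - {1..M})"
    then obtain m m' where m: "j = F l n m'" "m' \<in> {1..M}" "j = F i n m" "m \<in> {1..} - {1..M}"
      by blast
    have "F i n m = F l n m'" "m \<ge> 1" using m by auto
    then have "norm (W i m n / W l m' n - b m / b m') < \<epsilon>"
      using L il m(2) unfolding ratio_close_def by blast
    moreover have "finv (f i) n j = m" "finv (f l) n j = m'" "b m = 0"
      using finv[OF il(1), of m] finv[OF il(2), of m'] m by (auto simp: b)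
    ultimately show "norm (W i (finv (f i) n j) n / W l (finv (f l) n j) n) < \<epsilon>" by simp
  next
    fix i l j assume il: "i \<in> {1..N}" "l \<in> {1..N}" "i \<noteq> l"
      and "j \<in> F l n ` {1..M} \<inter> F i n ` {1..M}"
    then obtain m m' where m: "j = F l n m'" "m' \<in> {1..M}" "j = F i n m" "m \<in> {1..M}"
      by blast
    have "F i n m = F l n m'" "m \<ge> 1" using m by auto
    then have "norm (W i m n / W l m' n - b m / b m') < \<epsilon>"
      using L il m(2) unfolding ratio_close_def by blast
    moreover have "finv (f i) n j = m" "finv (f l) n j = m'" "b m = a m" "b m' = a m'"
      using finv[OF il(1), of m] finv[OF il(2), of m'] m by (auto simp: b)
    ultimately show "norm (W i (finv (f i) n j) n / W l (finv (f l) n j) n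
                       - a (finv (f i) n j) / a (finv (f l) n j)) < \<epsilon>" by simp
  qed
  show ?L if R: ?R
    unfolding ratio_close_def
  proof (intro ballI allI impI)
    fix i l m m' assume il: "i \<in> {1..N}" "l \<in> {1..N}" "i \<noteq> l"
      and m: "1 \<le> m" "m' \<in> {1..M}" "F i n m = F l n m'"
    have fi: "finv (f i) n (F l n m') = m" "finv (f l) n (F l n m') = m'"
      using finv[OF il(1) m(1)] finv[of l m'] il m by auto
    show "norm (W i m n / W l m' n - b m / b m') < \<epsilon>"
    proof (cases "m \<in> {1..M}")
      case True
      then have "F l n m' \<in> F l n ` {1..M} \<inter> F i n ` {1..M}"
        using m by (metis IntI imageI)
      then have "norm (W i m n / W l m' n - a m / a m') < \<epsilon>" using R il fi by metis
      then show ?thesis using True m by (simp add: b)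
    next
      case False
      then have "F l n m' \<in> F l n ` {1..M} \<inter> F i n ` ({1..} - {1..M})"
        using m by (metis DiffI IntI atLeast_iff imageI)
      then have "norm (W i m n / W l m' n) < \<epsilon>" using R il fi by metis
      moreover have "b m = 0" using False by (auto simp: b)
      ultimately show ?thesis by simp
    qed
  qed
qed

lemma weight_condition_alt:
  "weight_condition N f w \<longleftrightarrow>
     (\<exists>nk :: nat \<Rightarrow> nat. strict_mono nk \<and> (\<forall>k. nk k \<ge> 1) \<and>
        (\<forall>m\<ge>1. \<forall>i\<in>{1..N}. filterlim (\<lambda>k. norm (W i m (nk k))) at_top sequentially) \<and>
        (\<forall>\<epsilon>>0. \<forall>K M b. full_support M b \<longrightarrow> (\<exists>k\<ge>K. ratio_close N f w (nk k) \<epsilon> M b)))"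
proof -
  let ?A = "\<lambda>(nk :: nat \<Rightarrow> nat) k \<epsilon> M a. \<forall>i\<in>{1..N}. \<forall>l\<in>{1..N}. i \<noteq> l \<longrightarrow>
              (\<forall>j \<in> F l (nk k) ` {1..M} \<inter> F i (nk k) ` ({1..} - {1..M}).
                 norm (W i (finv (f i) (nk k) j) (nk k) / W l (finv (f l) (nk k) j) (nk k)) < \<epsilon>) \<and>
              (\<forall>j \<in> F l (nk k) ` {1..M} \<inter> F i (nk k) ` {1..M}.
                 norm (W i (finv (f i) (nk k) j) (nk k) / W l (finv (f l) (nk k) j) (nk k)
                       - a (finv (f i) (nk k) j) / a (finv (f l) (nk k) j)) < \<epsilon>)"
  have "(\<forall>K. \<forall>M\<ge>1. \<forall>a. (\<forall>m\<in>{1..M}. a m \<noteq> 0) \<longrightarrow> (\<exists>k\<ge>K. ?A nk k \<epsilon> M a))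
    \<longleftrightarrow> (\<forall>K M b. full_support M b \<longrightarrow> (\<exists>k\<ge>K. ratio_close N f w (nk k) \<epsilon> M b))" for nk \<epsilon>
  proof (intro iffI allI impI)
    fix K M and b :: "nat \<Rightarrow> 'k"
    assume H: "\<forall>K. \<forall>M\<ge>1. \<forall>a. (\<forall>m\<in>{1..M}. a m \<noteq> 0) \<longrightarrow> (\<exists>k\<ge>K. ?A nk k \<epsilon> M a)"
      and b: "full_support M b"
    have nz: "\<forall>m\<in>{1..M}. b m \<noteq> 0" using full_supportD(3)[OF b] by blast
    have eq: "b = (\<lambda>m. if m \<in> {1..M} then b m else 0)"
      using full_supportD(4)[OF b] by auto
    from H nz full_supportD(1)[OF b] obtain k where "k \<ge> K" "?A nk k \<epsilon> M b" by blast
    then show "\<exists>k\<ge>K. ratio_close N f w (nk k) \<epsilon> M b"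
      using ratio_close_iff[OF nz eq] by blast
  next
    fix K M and a :: "nat \<Rightarrow> 'k"
    assume H: "\<forall>K M b. full_support M b \<longrightarrow> (\<exists>k\<ge>K. ratio_close N f w (nk k) \<epsilon> M b)"
      and M: "M \<ge> 1" and nz: "\<forall>m\<in>{1..M}. a m \<noteq> 0"
    define b where "b = (\<lambda>m. if m \<in> {1..M} then a m else 0)"
    have "full_support M b" using M nz by (auto simp: full_support_def b_def)
    then obtain k where "k \<ge> K" "ratio_close N f w (nk k) \<epsilon> M b" using H by blast
    then show "\<exists>k\<ge>K. ?A nk k \<epsilon> M a" using ratio_close_iff[OF nz b_def] by blast
  qed
  then show ?thesis unfolding weight_condition_def by simp
qed

lemma T_funpow: "i \<in> {1..N} \<Longrightarrow> x 0 = 0 \<Longrightarrow> m \<ge> 1 \<Longrightarrow> (T i ^^ n) x m = W i m n * x (F i n m)"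
  by (simp add: pseudo_shift_funpow[OF data])

lemma T_funpow_0: "i \<in> {1..N} \<Longrightarrow> x 0 = 0 \<Longrightarrow> (T i ^^ n) x 0 = 0"
  by (simp add: pseudo_shift_funpow[OF data])

lemma lp_at_0: "x \<in> lp p \<Longrightarrow> x 0 = 0"
  by (simp add: lp_def)

lemma T_diff:
  "i \<in> {1..N} \<Longrightarrow> x \<in> lp p \<Longrightarrow> y \<in> lp p \<Longrightarrow> (T i ^^ n) (x - y) = (T i ^^ n) x - (T i ^^ n) y"
  by (intro pseudo_shift_funpow_diff data lp_at_0)

lemma T_uniformly_bounded:
  "\<exists>C\<ge>1. \<forall>i\<in>{1..N}. \<forall>x\<in>lp p. \<forall>n.
     (T i ^^ n) x \<in> lp p \<and> lp_norm p ((T i ^^ n) x) \<le> C ^ n * lp_norm p x"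
proof -
  have "\<forall>i. \<exists>C\<ge>1. i \<in> {1..N} \<longrightarrow> (\<forall>x\<in>lp p. T i x \<in> lp p \<and> lp_norm p (T i x) \<le> C * lp_norm p x)"
    using pseudo_shift_bounded[OF data p] by (metis order_refl)
  then obtain c where c: "\<And>i. c i \<ge> 1" "\<And>i x. i \<in> {1..N} \<Longrightarrow> x \<in> lp p \<Longrightarrow> T i x \<in> lp p"
    "\<And>i x. i \<in> {1..N} \<Longrightarrow> x \<in> lp p \<Longrightarrow> lp_norm p (T i x) \<le> c i * lp_norm p x"
    by metis
  define C where "C = 1 + (\<Sum>i\<in>{1..N}. c i)"
  have c0: "0 \<le> c i" for i using c(1)[of i] by simp
  have C: "C \<ge> 1" by (simp add: C_def sum_nonneg c0)
  have cC: "c i \<le> C" if "i \<in> {1..N}" for i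
    using member_le_sum[of i "{1..N}" c] that c0 by (simp add: C_def)
  have "(T i ^^ n) x \<in> lp p \<and> lp_norm p ((T i ^^ n) x) \<le> C ^ n * lp_norm p x"
    if "i \<in> {1..N}" "x \<in> lp p" for i x n
  proof (induction n)
    case (Suc n)
    have "lp_norm p (T i ((T i ^^ n) x)) \<le> c i * lp_norm p ((T i ^^ n) x)"
      using c(3) that Suc by blast
    also have "\<dots> \<le> C * (C ^ n * lp_norm p x)"
      using cC[OF that(1)] Suc C by (intro mult_mono) auto
    finally show ?case using c(2) that Suc by (simp add: mult.assoc)
  qed (use that in simp)
  then show ?thesis using C by blast
qed

lemma T_funpow_lp: "i \<in> {1..N} \<Longrightarrow> x \<in> lp p \<Longrightarrow> (T i ^^ n) x \<in> lp p"
  using T_uniformly_bounded by blast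

section \<open>Orbits accumulating on the diagonal force the weight conditions\<close>

lemma norm_weight_gt:
  assumes i: "i \<in> {1..N}" and m: "m \<ge> 1"
    and xj: "norm (W i m n * x (F i n m)) \<ge> r * \<eta>" "norm (x (F i n m)) < \<eta>" "0 < \<eta>"
  shows "r < norm (W i m n)"
proof (rule ccontr)
  assume "\<not> r < norm (W i m n)"
  moreover have "norm (W i m n) > 0" using Wprod_nonzero[OF data[OF i] m] by simp
  ultimately have "norm (W i m n) * norm (x (F i n m)) < r * \<eta>"
    using xj(2,3) by (intro mult_le_less_imp_less) auto
  then show False using xj(1) by (simp add: norm_mult)
qed

text \<open>At a common position both shifts read the same entry of \<open>x\<close>, which cancels
  in a quotient. The quotient of the weights is therefore \<open>u / v\<close> with \<open>u\<close>
  close to \<open>b m\<close> and \<open>v\<close> close to \<open>b m'\<close>.\<close>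

lemma ratio_close_from_orbit:
  assumes b: "full_support M b" and \<epsilon>: "\<epsilon> > 0"
  obtains \<delta> where "\<delta> > 0"
    "\<And>x n. (\<forall>i\<in>{1..N}. \<forall>m\<ge>1. norm (W i m n * x (F i n m) - b m) < \<delta>) \<Longrightarrow> ratio_close N f w n \<epsilon> M b"
proof -
  obtain B where B: "0 < B" "\<And>m. norm (b m) \<le> B" using full_support_bounded[OF b] by metis
  obtain \<beta> where \<beta>: "0 < \<beta>" "\<And>m. m \<in> {1..M} \<Longrightarrow> \<beta> \<le> norm (b m)"
    using finite_positive_lower_bound[of "{1..M}" "\<lambda>m. norm (b m)"] full_supportD(3)[OF b] by auto
  \<comment> \<open>The first bound keeps \<open>norm v\<close> at least \<open>\<beta> / 2\<close>.
    The second makes the numerator, which is below \<open>2 * B * \<delta>\<close>, smaller than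
    \<open>\<epsilon>\<close> times the lower bound \<open>\<beta>\<^sup>2 / 2\<close> of the
    denominator.\<close>
  define \<delta> where "\<delta> = min (\<beta> / 2) (\<epsilon> * \<beta>\<^sup>2 / (4 * B))"
  have \<delta>: "0 < \<delta>" "\<delta> \<le> \<beta> / 2" "\<delta> * (4 * B) \<le> \<epsilon> * \<beta>\<^sup>2"
    using \<beta>(1) B(1) \<epsilon> by (auto simp: \<delta>_def min_def field_simps)
  have "ratio_close N f w n \<epsilon> M b"
    if H: "\<forall>i\<in>{1..N}. \<forall>m\<ge>1. norm (W i m n * x (F i n m) - b m) < \<delta>" for x n
    unfolding ratio_close_def
  proof (intro ballI allI impI)
    fix i l m m' assume il: "i \<in> {1..N}" "l \<in> {1..N}" "i \<noteq> l"
      and m: "1 \<le> m" "m' \<in> {1..M}" "F i n m = F l n m'"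
    define u v where "u = W i m n * x (F l n m')" and "v = W l m' n * x (F l n m')"
    have u: "norm (u - b m) < \<delta>" using H il(1) m unfolding u_def by metis
    have v: "norm (v - b m') < \<delta>" using H il(2) m unfolding v_def by auto
    have bm': "\<beta> \<le> norm (b m')" using \<beta>(2) m by blast
    have nv: "\<beta> / 2 \<le> norm v"
      using norm_triangle_ineq2[of "b m'" "b m' - v"] v bm' \<delta>(2) by (simp add: norm_minus_commute)
    then have nz: "v \<noteq> 0" "b m' \<noteq> 0" using \<beta>(1) bm' by auto
    have "x (F l n m') \<noteq> 0" using nz(1) by (auto simp: v_def)
    then have "W i m n / W l m' n = u / v" by (simp add: u_def v_def)
    also have "u / v - b m / b m' = ((u - b m) * b m' - b m * (v - b m')) / (v * b m')"
      using nz by (simp add: field_simps)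
    also have "norm \<dots> = norm ((u - b m) * b m' - b m * (v - b m')) / (norm v * norm (b m'))"
      by (simp add: norm_divide norm_mult)
    also have "\<dots> < \<epsilon>"
    proof -
      have "norm ((u - b m) * b m' - b m * (v - b m')) \<le> norm (u - b m) * norm (b m') + norm (b m) * norm (v - b m')"
        by (rule order.trans[OF norm_triangle_ineq4]) (simp add: norm_mult)
      also have "\<dots> < \<delta> * B + B * \<delta>"
      proof (rule add_less_le_mono)
        show "norm (u - b m) * norm (b m') < \<delta> * B"
          using u B nz(2) by (intro mult_less_le_imp_less) auto
        show "norm (b m) * norm (v - b m') \<le> B * \<delta>"
          using v B by (intro mult_mono) (auto intro: less_imp_le)
      qed
      also have "\<dots> \<le> \<epsilon> * (\<beta> / 2 * \<beta>)" using \<delta>(3) by (simp add: power2_eq_square algebra_simps)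
      also have "\<dots> \<le> \<epsilon> * (norm v * norm (b m'))"
        using \<epsilon> \<beta>(1) nv bm' by (intro mult_left_mono mult_mono) auto
      finally show ?thesis using nz by (simp add: divide_less_eq)
    qed
    finally show "norm (W i m n / W l m' n - b m / b m') < \<epsilon>" .
  qed
  then show ?thesis using that \<delta>(1) by blast
qed

text \<open>A slight change of coordinate 1 makes the target differ there from
  \<open>(T 1 ^^ n) x\<close> for each of the finitely many \<open>n < n0\<close>. These iterates
  keep a positive distance from the new target, so a sufficiently good approximation occurs only at
  some \<open>n \<ge> n0\<close>.\<close>

lemma orbit_returns_late:
  assumes N: "1 \<le> N" and x: "x \<in> lp p"
    and orbit: "\<forall>y\<in>lp p. \<forall>\<epsilon>>0. \<exists>n\<ge>1. \<forall>i\<in>{1..N}. lp_norm p ((T i ^^ n) x - y) < \<epsilon>"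
    and y: "y \<in> lp p" and \<epsilon>: "\<epsilon> > 0"
  shows "\<exists>n\<ge>n0. \<forall>i\<in>{1..N}. lp_norm p ((T i ^^ n) x - y) < \<epsilon>"
proof -
  have 1: "1 \<in> {1..N}" using N by simp
  have "infinite ((of_real :: real \<Rightarrow> 'k) ` {0<..<\<epsilon> / 2})"
    using \<epsilon> by (subst finite_image_iff) (auto simp: inj_on_def infinite_Ioo)
  moreover have "finite ((\<lambda>n. (T 1 ^^ n) x 1 - y 1) ` {..<n0})" by simp
  ultimately have "\<not> (of_real :: real \<Rightarrow> 'k) ` {0<..<\<epsilon> / 2} \<subseteq> (\<lambda>n. (T 1 ^^ n) x 1 - y 1) ` {..<n0}"
    using finite_subset by blast
  then obtain t :: real where t0: "t \<in> {0<..<\<epsilon> / 2}"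
    "of_real t \<notin> (\<lambda>n. (T 1 ^^ n) x 1 - y 1) ` {..<n0}" by blast
  then have t: "0 < t" "t < \<epsilon> / 2" by simp_all
  have t_new: "(T 1 ^^ n) x 1 - y 1 \<noteq> of_real t" if "n < n0" for n
  proof
    assume "(T 1 ^^ n) x 1 - y 1 = of_real t"
    then have "of_real t \<in> (\<lambda>n. (T 1 ^^ n) x 1 - y 1) ` {..<n0}"
      using that by (intro image_eqI[of _ _ n]) simp_all
    then show False using t0(2) by contradiction
  qed
  define s :: "nat \<Rightarrow> 'k" where "s = (\<lambda>m. if m = 1 then of_real t else 0)"
  have s: "s \<in> lp p" "lp_norm p s \<le> t"
    using lp_finite_support[OF p, of s "{1}" t] t(1) by (auto simp: s_def)
  define y' where "y' = (\<lambda>m. y m + s m)"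
  have y': "y' \<in> lp p" unfolding y'_def by (rule lp_add(1)[OF p y s(1)])
  have "y' - y = s" by (simp add: y'_def fun_eq_iff)
  then have y'y: "lp_norm p (y' - y) < \<epsilon> / 2" using s(2) t(2) by simp
  have "0 < norm ((T 1 ^^ n) x 1 - y' 1)" if "n \<in> {..<n0}" for n
    using t_new[of n] that by (auto simp: y'_def s_def algebra_simps)
  then obtain d where d: "0 < d" "\<And>n. n \<in> {..<n0} \<Longrightarrow> d \<le> norm ((T 1 ^^ n) x 1 - y' 1)"
    using finite_positive_lower_bound[of "{..<n0}" "\<lambda>n. norm ((T 1 ^^ n) x 1 - y' 1)"] finite_lessThan
    by blast
  obtain n where n: "\<forall>i\<in>{1..N}. lp_norm p ((T i ^^ n) x - y') < min (\<epsilon> / 2) d"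
    using orbit y' \<epsilon> d(1) by (metis half_gt_zero min_less_iff_conj)
  have "n \<ge> n0"
  proof (rule ccontr)
    assume "\<not> n \<ge> n0"
    then have "d \<le> norm (((T 1 ^^ n) x - y') 1)" using d(2) by simp
    also have "\<dots> \<le> lp_norm p ((T 1 ^^ n) x - y')"
      by (intro norm_le_lp_norm[OF p] lp_diff[OF p] T_funpow_lp 1 x y')
    finally show False using n 1 by fastforce
  qed
  moreover have "lp_norm p ((T i ^^ n) x - y) < \<epsilon>" if "i \<in> {1..N}" for i
    using lp_norm_triangle[OF p T_funpow_lp[OF that x] y' y, of n] n that y'y by fastforce
  ultimately show ?thesis by blast
qed

lemma weights_from_orbit:
  assumes N: "1 \<le> N" and x: "x \<in> lp p"
    and orbit: "\<forall>y\<in>lp p. \<forall>\<epsilon>>0. \<exists>n\<ge>1. \<forall>i\<in>{1..N}. lp_norm p ((T i ^^ n) x - y) < \<epsilon>"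
    and b: "full_support M b" and \<delta>: "\<delta> > 0"
  shows "\<exists>n\<ge>n0. \<forall>i\<in>{1..N}. \<forall>m\<ge>1. norm (W i m n * x (F i n m) - b m) < \<delta> \<and>
           (m \<le> r \<longrightarrow> real r < norm (W i m n))"
proof -
  define R where "R = max M r"
  \<comment> \<open>Between \<open>M\<close> and \<open>R\<close> the target gets
    \<open>\<delta> / 2\<close> instead of 0, since a weight can be forced to be large only at a
    coordinate where the target is nonzero.\<close>
  define y where "y = (\<lambda>m. if m \<in> {1..M} then b m else if m \<in> {1..R} then of_real (\<delta> / 2) else 0)"
  have y: "full_support R y"
    using full_supportD[OF b] \<delta> by (auto simp: full_support_def y_def R_def)
  have yb: "norm (y m - b m) \<le> \<delta> / 2" for m
    using full_supportD(4)[OF b, of m] \<delta> by (auto simp: y_def simp del: of_real_divide)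
  obtain \<mu> where \<mu>: "0 < \<mu>" "\<And>m. m \<in> {1..R} \<Longrightarrow> \<mu> \<le> norm (y m)"
    using finite_positive_lower_bound[of "{1..R}" "\<lambda>m. norm (y m)"] full_supportD(3)[OF y] by auto
  \<comment> \<open>From \<open>n1\<close> on the entries of \<open>x\<close> are below
    \<open>\<eta>\<close>, while their products with the weights are at least
    \<open>\<mu> / 2\<close>, hence at least \<open>r * \<eta>\<close>; so these weights exceed
    \<open>r\<close>.\<close>
  define \<eta> where "\<eta> = \<mu> / (2 * (real r + 1))"
  have \<eta>: "\<eta> > 0" "real r * \<eta> \<le> \<mu> / 2" using \<mu>(1) by (auto simp: \<eta>_def field_simps)
  obtain n1 where n1: "\<And>j. j \<ge> n1 \<Longrightarrow> norm (x j) < \<eta>"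
    using lp_coord_tendsto_0[OF p x] \<eta>(1) unfolding LIMSEQ_iff by auto
  obtain n where n: "n \<ge> max n0 n1" "\<forall>i\<in>{1..N}. lp_norm p ((T i ^^ n) x - y) < min (\<delta> / 2) (\<mu> / 2)"
    using orbit_returns_late[OF N x orbit full_support_lp[OF p y], of "min (\<delta> / 2) (\<mu> / 2)" "max n0 n1"]
      \<delta> \<mu>(1) by auto
  have "norm (W i m n * x (F i n m) - b m) < \<delta> \<and> (m \<le> r \<longrightarrow> real r < norm (W i m n))"
    if i: "i \<in> {1..N}" and m: "m \<ge> 1" for i m
  proof -
    have "norm (((T i ^^ n) x - y) m) \<le> lp_norm p ((T i ^^ n) x - y)"
      by (intro norm_le_lp_norm[OF p] lp_diff[OF p] T_funpow_lp i x full_support_lp[OF p y])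
    then have near: "norm (W i m n * x (F i n m) - y m) < min (\<delta> / 2) (\<mu> / 2)"
      using n(2) i T_funpow[of i x m n] lp_at_0[OF x] m by fastforce
    have "norm (W i m n * x (F i n m) - b m) < \<delta>"
      using norm_triangle_ineq[of "W i m n * x (F i n m) - y m" "y m - b m"] near yb[of m] by simp
    moreover have "real r < norm (W i m n)" if "m \<le> r"
    proof (rule norm_weight_gt[OF i m _ _ \<eta>(1)])
      have "\<mu> \<le> norm (y m)" using \<mu>(2) that m by (simp add: R_def)
      then show "real r * \<eta> \<le> norm (W i m n * x (F i n m))"
        using norm_triangle_ineq2[of "y m" "y m - W i m n * x (F i n m)"] near \<eta>(2)
        by (simp add: norm_minus_commute)
      show "norm (x (F i n m)) < \<eta>"
        using n1 n(1) shift_map_ge[OF data[OF i] m, of n] by simp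
    qed
    ultimately show ?thesis by blast
  qed
  then show ?thesis using n(1) by (intro exI[of _ n]) auto
qed

lemma s_hypercyclic_imp_weight_condition:
  assumes N: "1 \<le> N" and "s_hypercyclic p N T"
  shows "weight_condition N f w"
proof -
  obtain x where x: "x \<in> lp p"
    and orbit: "\<forall>y\<in>lp p. \<forall>\<epsilon>>0. \<exists>n\<ge>1. \<forall>i\<in>{1..N}. lp_norm p ((T i ^^ n) x - y) < \<epsilon>"
    using assms(2) unfolding s_hypercyclic_def by blast
  obtain V :: "nat \<Rightarrow> nat \<Rightarrow> 'k" where V: "\<And>n. \<exists>M. full_support M (V n)"
    "\<And>M x \<epsilon> K. full_support M x \<Longrightarrow> \<epsilon> > 0 \<Longrightarrow>
       \<exists>n\<ge>K. full_support M (V n) \<and> (\<forall>m. norm (V n m - x m) < \<epsilon>)"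
    using countable_dense_full_support by metis
  \<comment> \<open>Time \<open>nk k\<close> serves the single target \<open>V k\<close>. Any
    \<open>b\<close> is approximated by \<open>V k\<close> for arbitrarily late \<open>k\<close>, so
    one sequence handles all \<open>b\<close> and all tolerances. The last clause gives divergence
    for each fixed \<open>m\<close>, as it applies once \<open>k \<ge> m\<close>.\<close>
  define P where "P = (\<lambda>k n. n \<ge> 1 \<and> (\<forall>i\<in>{1..N}. \<forall>m\<ge>1.
      norm (W i m n * x (F i n m) - V k m) < 1 / (real k + 1) \<and> (m \<le> k \<longrightarrow> real k < norm (W i m n))))"
  have step: "\<exists>n\<ge>n0. P k n" for k n0
  proof -
    obtain M where "full_support M (V k)" using V(1) by blast
    from weights_from_orbit[OF N x orbit this, of "1 / (real k + 1)" "max n0 1" k]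
    show ?thesis unfolding P_def by (auto simp: Suc_le_eq)
  qed
  have "\<exists>nk. \<forall>k. P k (nk k) \<and> nk k < nk (Suc k)"
    by (rule dependent_nat_choice) (use step in \<open>meson Suc_le_lessD\<close>)+
  then obtain nk where nk: "\<And>k. P k (nk k)" "\<And>k. nk k < nk (Suc k)" by blast
  have "filterlim (\<lambda>k. norm (W i m (nk k))) at_top sequentially" if "m \<ge> 1" "i \<in> {1..N}" for m i
  proof (rule filterlim_at_top_mono[OF filterlim_real_sequentially])
    show "\<forall>\<^sub>F k in sequentially. real k \<le> norm (W i m (nk k))"
      using eventually_ge_at_top[of m]
      by eventually_elim (use nk(1) that in \<open>auto simp: P_def intro: less_imp_le\<close>)
  qed
  moreover have "\<exists>k\<ge>K. ratio_close N f w (nk k) \<epsilon> M b" if \<epsilon>: "\<epsilon> > 0" and b: "full_support M b" for \<epsilon> K M b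
  proof -
    obtain \<delta> where \<delta>: "\<delta> > 0"
      "\<And>x n. (\<forall>i\<in>{1..N}. \<forall>m\<ge>1. norm (W i m n * x (F i n m) - b m) < \<delta>) \<Longrightarrow> ratio_close N f w n \<epsilon> M b"
      using ratio_close_from_orbit[OF b \<epsilon>] by metis
    obtain K' :: nat where K': "1 / (real K' + 1) < \<delta> / 2"
      using reals_Archimedean[of "\<delta> / 2"] \<delta>(1) by (auto simp: inverse_eq_divide add.commute)
    obtain k where k: "k \<ge> max K K'" "\<forall>m. norm (V k m - b m) < \<delta> / 2"
      using V(2)[OF b, of "\<delta> / 2" "max K K'"] \<delta>(1) by auto
    have "1 / (real k + 1) \<le> 1 / (real K' + 1)" using k(1) by (intro divide_left_mono) auto
    then have k': "1 / (real k + 1) < \<delta> / 2" using K' by simp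
    have "norm (W i m (nk k) * x (F i (nk k) m) - b m) < \<delta>" if "i \<in> {1..N}" "m \<ge> 1" for i m
    proof -
      have "norm (W i m (nk k) * x (F i (nk k) m) - V k m) < 1 / (real k + 1)"
        using nk(1)[of k] that unfolding P_def by blast
      then show ?thesis
        using norm_triangle_ineq[of "W i m (nk k) * x (F i (nk k) m) - V k m" "V k m - b m"] k' spec[OF k(2), of m]
        by simp
    qed
    then have "ratio_close N f w (nk k) \<epsilon> M b"
      by (intro \<delta>(2)[of "nk k" x]) blast
    then show ?thesis using k(1) by auto
  qed
  moreover have "strict_mono nk" using nk(2) by (simp add: strict_mono_Suc_iff)
  moreover have "nk k \<ge> 1" for k using nk(1)[of k] by (simp add: P_def)
  ultimately show ?thesis unfolding weight_condition_alt by blast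
qed


section \<open>Approximate preimages from the weight conditions\<close>

text \<open>The coordinates forced by the shifts \<open>i\<close> and \<open>l\<close> at a common position \<open>j\<close> may disagree; \<open>y\<close> uses
  any one of them, and \<open>ratio_close\<close> says that the choice does not matter.\<close>

lemma common_approximate_preimage:
  assumes x: "full_support M x" and B: "0 < B" "\<And>m. norm (x m) \<le> B"
  shows "\<exists>y\<in>lp p. \<forall>R>0. \<forall>\<epsilon>>0.
     (\<forall>i\<in>{1..N}. \<forall>m\<in>{1..M}. R \<le> norm (W i m n)) \<longrightarrow> ratio_close N f w n \<epsilon> M x \<longrightarrow>
       lp_norm p y \<le> real (N * M) * (B / R) \<and>
       (\<forall>i\<in>{1..N}. lp_norm p ((T i ^^ n) y - x) \<le> real (N * M) * (B * \<epsilon>))"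
proof -
  define J where "J = (\<Union>l\<in>{1..N}. F l n ` {1..M})"
  have finJ: "finite J" by (simp add: J_def)
  have "card J \<le> (\<Sum>l\<in>{1..N}. card (F l n ` {1..M}))"
    unfolding J_def by (rule card_UN_le) simp
  also have "\<dots> \<le> (\<Sum>l\<in>{1..N}. M)"
    by (intro sum_mono order.trans[OF card_image_le]) auto
  finally have cardJ: "card J \<le> N * M" by simp
  have "\<exists>l m. j \<in> J \<longrightarrow> l \<in> {1..N} \<and> m \<in> {1..M} \<and> j = F l n m" for j
    unfolding J_def by blast
  then obtain L m' where Lm: "\<And>j. j \<in> J \<Longrightarrow> L j \<in> {1..N}" "\<And>j. j \<in> J \<Longrightarrow> m' j \<in> {1..M}"
    "\<And>j. j \<in> J \<Longrightarrow> j = F (L j) n (m' j)" by metis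
  define y where "y = (\<lambda>j. if j \<in> J then x (m' j) / W (L j) (m' j) n else 0)"
  have "0 \<notin> J"
  proof
    assume "0 \<in> J"
    then obtain l m where "l \<in> {1..N}" "m \<in> {1..M}" "F l n m = 0" by (auto simp: J_def)
    then show False using shift_map_ge_1[OF data, of l m n] by simp
  qed
  then have y0: "y 0 = 0" by (simp add: y_def)
  have y: "y \<in> lp p \<and> lp_norm p y \<le> real (card J) * (B / R)"
    if R: "0 < R" "\<And>i m. i \<in> {1..N} \<Longrightarrow> m \<in> {1..M} \<Longrightarrow> R \<le> norm (W i m n)" for R
  proof -
    have "norm (y j) \<le> B / R" for j
      using B R(1) R(2)[OF Lm(1,2)] by (auto simp: y_def norm_divide intro!: frac_le)
    then show ?thesis
      using lp_finite_support[OF p, of y J "B / R"] finJ y0 by (auto simp: y_def)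
  qed
  \<comment> \<open>Membership must hold for every \<open>n\<close>, also when the weights are not
    known to be large; only finitely many nonzero weights occur, so some \<open>R\<close>
    exists.\<close>
  have "y \<in> lp p"
  proof -
    have "0 < norm (W (fst im) (snd im) n)" if "im \<in> {1..N} \<times> {1..M}" for im
      using that Wprod_nonzero[OF data] by auto
    moreover have "finite ({1..N} \<times> {1..M})" by simp
    ultimately obtain R where R: "0 < R" "\<And>im. im \<in> {1..N} \<times> {1..M} \<Longrightarrow> R \<le> norm (W (fst im) (snd im) n)"
      using finite_positive_lower_bound[of "{1..N} \<times> {1..M}" "\<lambda>im. norm (W (fst im) (snd im) n)"] by blast
    have "R \<le> norm (W i m n)" if "i \<in> {1..N}" "m \<in> {1..M}" for i m
      using R(2)[of "(i, m)"] that by simp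
    from y[OF R(1) this] show ?thesis by blast
  qed
  moreover have "lp_norm p ((T i ^^ n) y - x) \<le> real (N * M) * (B * \<epsilon>)"
    if i: "i \<in> {1..N}" and \<epsilon>: "0 < \<epsilon>" "ratio_close N f w n \<epsilon> M x" for i \<epsilon>
  proof -
    \<comment> \<open>\<open>G\<close> contains \<open>{1..M}\<close> but may reach beyond it, when
      shift \<open>i\<close> reads an entry of \<open>y\<close> that was placed for another shift.
      There \<open>x m = 0\<close>, and the part of (b) about indices outside \<open>{1..M}\<close>
      bounds the error.\<close>
    define G where "G = {m. m \<ge> 1 \<and> F i n m \<in> J}"
    have injG: "inj_on (F i n) G"
      by (rule inj_on_subset[OF inj_shift_map[OF data[OF i]]]) (auto simp: G_def)
    moreover have GJ: "F i n ` G \<subseteq> J" by (auto simp: G_def)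
    ultimately have G: "finite G" "card G \<le> card J"
      using finJ by (auto intro: inj_on_finite card_inj_on_le)
    have MG: "m \<in> G" if "m \<in> {1..M}" for m
    proof -
      have "F i n m \<in> J" unfolding J_def using that i by blast
      then show ?thesis using that by (simp add: G_def)
    qed
    let ?z = "(T i ^^ n) y - x"
    have z: "?z m = W i m n * y (F i n m) - x m" if "m \<ge> 1" for m
      using T_funpow[of i y m n] i y0 that by simp
    have z0: "?z 0 = 0" using T_funpow_0[of i y n] i y0 full_supportD(2)[OF x] by simp
    have out: "?z m = 0" if "m \<notin> G" for m
    proof (cases "m = 0")
      case False
      then have "F i n m \<notin> J" "x m = 0"
        using that MG full_supportD(4)[OF x] by (auto simp: G_def)
      then show ?thesis using z[of m] False by (simp add: y_def)
    qed (use z0 in simp)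
    have "norm (?z m) \<le> B * \<epsilon>" for m
    proof (cases "m \<in> G")
      case True
      then have m: "m \<ge> 1" and j: "F i n m \<in> J" by (auto simp: G_def)
      define l k where "l = L (F i n m)" and "k = m' (F i n m)"
      have l: "l \<in> {1..N}" and k: "k \<in> {1..M}" and eq: "F i n m = F l n k"
        using Lm[OF j] by (simp_all only: l_def k_def)
      have xk: "x k \<noteq> 0" using full_supportD(3)[OF x k] .
      \<comment> \<open>Factoring out the nonzero \<open>x k\<close> exposes exactly the quantity
        that \<open>ratio_close\<close> controls.\<close>
      have "?z m = x k * (W i m n / W l k n - x m / x k)"
        using z[OF m] j xk by (simp add: y_def l_def k_def right_diff_distrib)
      then have "norm (?z m) = norm (x k) * norm (W i m n / W l k n - x m / x k)"
        by (simp add: norm_mult)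
      also have "\<dots> \<le> B * \<epsilon>"
      proof (intro mult_mono B(2))
        show "norm (W i m n / W l k n - x m / x k) \<le> \<epsilon>"
        \<comment> \<open>Within one shift a position has only one preimage, and the difference
          vanishes.\<close>
        proof (cases "i = l")
          case True
          then have "m = k"
            using eq m k inj_onD[OF inj_shift_map[OF data[OF i]], of n m k] by simp
          then show ?thesis
            using True xk \<epsilon>(1) Wprod_nonzero[OF data[OF i] m] by simp
        next
          case False
          then show ?thesis
            using \<epsilon>(2) i l k m eq unfolding ratio_close_def by (meson less_imp_le)
        qed
      qed (use B in auto)
      finally show ?thesis .
    next
      case False
      then show ?thesis using out[of m] B(1) \<epsilon>(1) by simp
    qed
    then have "lp_norm p ?z \<le> real (card G) * (B * \<epsilon>)"
      using lp_finite_support(2)[of p ?z G "B * \<epsilon>"] p z0 G(1) out by blast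
    also have "\<dots> \<le> real (N * M) * (B * \<epsilon>)"
    proof (rule mult_right_mono)
      show "real (card G) \<le> real (N * M)" using G(2) cardJ by linarith
    qed (use B(1) \<epsilon>(1) in simp)
    finally show ?thesis .
  qed
  moreover have "lp_norm p y \<le> real (N * M) * (B / R)"
    if R: "0 < R" "\<And>i m. i \<in> {1..N} \<Longrightarrow> m \<in> {1..M} \<Longrightarrow> R \<le> norm (W i m n)" for R
  proof -
    have "real (card J) * (B / R) \<le> real (N * M) * (B / R)"
      using cardJ B(1) R(1) by (intro mult_right_mono) (auto simp del: of_nat_mult)
    then show ?thesis using y[OF R] by linarith
  qed
  ultimately show ?thesis by (intro bexI[of _ y]) blast+
qed

lemma weight_condition_imp_blowup_collapse:
  assumes "weight_condition N f w"
  shows "simultaneous_blowup_collapse p N T"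
proof -
  obtain nk :: "nat \<Rightarrow> nat" where nk: "strict_mono nk" "\<And>k. nk k \<ge> 1"
    and blow: "\<And>m i. m \<ge> 1 \<Longrightarrow> i \<in> {1..N} \<Longrightarrow> filterlim (\<lambda>k. norm (W i m (nk k))) at_top sequentially"
    and close: "\<And>\<epsilon> K M b. \<epsilon> > 0 \<Longrightarrow> full_support M b \<Longrightarrow> \<exists>k\<ge>K. ratio_close N f w (nk k) \<epsilon> M b"
    using assms unfolding weight_condition_alt by blast
  define X0 :: "(nat \<Rightarrow> 'k) set" where "X0 = {x. \<exists>M. full_support M x}"
  have X0: "X0 \<subseteq> lp p" using full_support_lp[OF p] by (auto simp: X0_def)
  have dense: "\<exists>x\<in>X0. lp_norm p (x - y) < \<epsilon>" if "y \<in> lp p" "\<epsilon> > 0" for y \<epsilon>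
    using full_support_dense[OF p that] unfolding X0_def by blast
  have collapse: "(\<lambda>k. lp_norm p ((T i ^^ nk k) x)) \<longlonglongrightarrow> 0" if "x \<in> X0" "i \<in> {1..N}" for x :: "nat \<Rightarrow> 'k" and i
  proof -
    obtain M where M: "full_support M x" using \<open>x \<in> X0\<close> unfolding X0_def by blast
    \<comment> \<open>The collapse is exact: for \<open>k \<ge> M\<close> every coordinate that is
      read lies beyond the support of \<open>x\<close>.\<close>
    have "lp_norm p ((T i ^^ nk k) x) = 0" if "k \<ge> M" for k
    proof -
      have "(T i ^^ nk k) x m = 0" for m
      proof (cases "m = 0")
        case False
        have "k \<le> nk k" using seq_suble[OF nk(1)] .
        then have "F i (nk k) m \<notin> {1..M}"
          using shift_map_ge[OF data[OF \<open>i \<in> {1..N}\<close>], of m "nk k"] False that by simp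
        then show ?thesis
          using T_funpow[of i x m "nk k"] full_supportD(2,4)[OF M] False \<open>i \<in> {1..N}\<close> by simp
      qed (use T_funpow_0 full_supportD(2)[OF M] \<open>i \<in> {1..N}\<close> in simp)
      then show ?thesis by (simp add: lp_norm_def)
    qed
    then show ?thesis
      by (intro tendsto_eventually) (auto simp: eventually_sequentially)
  qed
  have "\<forall>x\<in>X0. \<exists>M B. full_support M x \<and> 0 < B \<and> (\<forall>m. norm (x m) \<le> B)"
    unfolding X0_def using full_support_bounded by blast
  then obtain M B where MB: "\<And>x. x \<in> X0 \<Longrightarrow> full_support (M x) x" "\<And>x. x \<in> X0 \<Longrightarrow> 0 < B x"
    "\<And>x m. x \<in> X0 \<Longrightarrow> norm (x m) \<le> B x"
    by metis
  \<comment> \<open>\<open>S k x\<close> may not depend on the tolerance, so \<open>good\<close>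
    collects the estimates for all \<open>R\<close> and \<open>\<epsilon>\<close>, each guarded by
    its hypotheses; membership in \<open>lp p\<close> is unconditional.\<close>
  define good where "good = (\<lambda>k x y. y \<in> lp p \<and> (\<forall>R>0. \<forall>\<epsilon>>0.
     (\<forall>i\<in>{1..N}. \<forall>m\<in>{1..M x}. R \<le> norm (W i m (nk k))) \<longrightarrow> ratio_close N f w (nk k) \<epsilon> (M x) x \<longrightarrow>
       lp_norm p y \<le> real (N * M x) * (B x / R) \<and>
       (\<forall>i\<in>{1..N}. lp_norm p ((T i ^^ nk k) y - x) \<le> real (N * M x) * (B x * \<epsilon>))))"
  have ex_good: "\<exists>y. good k x y" if "x \<in> X0" for k x
    unfolding good_def by (intro common_approximate_preimage[unfolded Bex_def] MB that)
  define S where "S = (\<lambda>k x. SOME y. good k x y)"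
  have good: "good k x (S k x)" if "x \<in> X0" for k x
    unfolding S_def by (rule someI_ex[OF ex_good[OF that]])
  then have S: "\<And>k x. x \<in> X0 \<Longrightarrow> S k x \<in> lp p" by (simp add: good_def)
  have "\<exists>k\<ge>K. lp_norm p (S k x) < \<epsilon> \<and> (\<forall>i\<in>{1..N}. lp_norm p ((T i ^^ nk k) (S k x) - x) < \<epsilon>)"
    if x: "x \<in> X0" and \<epsilon>: "\<epsilon> > 0" for x \<epsilon> K
  proof -
    note B = MB(2)[OF x]
    \<comment> \<open>\<open>c\<close> is positive and exceeds the factor \<open>N * M x\<close> of
      the error bounds. With \<open>R\<close> and \<open>\<epsilon>'\<close> below, both bounds
      become \<open>real (N * M x) * (\<epsilon> / c)\<close>, which is less than
      \<open>\<epsilon>\<close>.\<close>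
    define c where "c = real (N * M x) + 1"
    have c: "c > 0" "real (N * M x) < c" by (auto simp: c_def intro: add_nonneg_pos)
    define R where "R = c * B x / \<epsilon>"
    have R: "R > 0" using c(1) B \<epsilon> by (simp add: R_def)
    have "\<forall>\<^sub>F k in sequentially. \<forall>im\<in>{1..N} \<times> {1..M x}. R \<le> norm (W (fst im) (snd im) (nk k))"
      by (intro eventually_ball_finite) (use blow in \<open>auto simp: filterlim_at_top\<close>)
    then obtain K' where K': "\<And>k. k \<ge> K' \<Longrightarrow> \<forall>im\<in>{1..N} \<times> {1..M x}. R \<le> norm (W (fst im) (snd im) (nk k))"
      unfolding eventually_sequentially by blast
    define \<epsilon>' where "\<epsilon>' = \<epsilon> / (c * B x)"
    have \<epsilon>': "\<epsilon>' > 0" using \<epsilon> c(1) B by (simp add: \<epsilon>'_def)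
    obtain k where k: "k \<ge> max K K'" "ratio_close N f w (nk k) \<epsilon>' (M x) x"
      using close[OF \<epsilon>' MB(1)[OF x]] by blast
    have small: "real (N * M x) * (B x / R) < \<epsilon>" "real (N * M x) * (B x * \<epsilon>') < \<epsilon>"
    proof -
      have "B x / R = \<epsilon> / c" "B x * \<epsilon>' = \<epsilon> / c" using B by (simp_all add: R_def \<epsilon>'_def)
      moreover have "real (N * M x) * (\<epsilon> / c) < \<epsilon>"
        using mult_strict_right_mono[OF c(2) \<epsilon>] c(1) by (simp add: divide_less_eq mult.commute)
      ultimately show "real (N * M x) * (B x / R) < \<epsilon>" "real (N * M x) * (B x * \<epsilon>') < \<epsilon>" by simp_all
    qed
    have "\<forall>i\<in>{1..N}. \<forall>m\<in>{1..M x}. R \<le> norm (W i m (nk k))"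
      using K'[of k] k(1) by simp
    then have "lp_norm p (S k x) \<le> real (N * M x) * (B x / R)"
      "\<forall>i\<in>{1..N}. lp_norm p ((T i ^^ nk k) (S k x) - x) \<le> real (N * M x) * (B x * \<epsilon>')"
      using good[OF x, of k] R \<epsilon>' k(2) unfolding good_def by blast+
    then show ?thesis
      using k(1) small by (meson le_less_trans max.boundedE)
  qed
  then show ?thesis
    unfolding simultaneous_blowup_collapse_def
    using nk X0 dense collapse S by (intro exI[of _ nk] exI[of _ X0] exI[of _ S]) simp
qed

section \<open>Construction of the universal vector\<close>

lemma blowup_collapse_imp_s_hypercyclic:
  assumes "simultaneous_blowup_collapse p N T"
  shows "s_hypercyclic p N T"
proof -
  obtain nk X0 S where mono: "strict_mono nk" and nk: "\<forall>k. nk k \<ge> 1"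
    and X0: "X0 \<subseteq> lp p"
    and dense': "\<forall>y\<in>lp p. \<forall>\<epsilon>>0. \<exists>x\<in>X0. lp_norm p (x - y) < \<epsilon>"
    and S': "\<forall>k. \<forall>x\<in>X0. S k x \<in> lp p"
    and collapse': "\<forall>x\<in>X0. \<forall>i\<in>{1..N}. (\<lambda>k. lp_norm p ((T i ^^ nk k) x)) \<longlonglongrightarrow> 0"
    and blowup': "\<forall>\<epsilon>>0. \<forall>K. \<forall>x0\<in>X0. \<exists>k\<ge>K. lp_norm p (S k x0) < \<epsilon> \<and>
             (\<forall>i\<in>{1..N}. lp_norm p ((T i ^^ nk k) (S k x0) - x0) < \<epsilon>)"
    using assms unfolding simultaneous_blowup_collapse_def by (elim exE conjE) (rule that)
  have dense: "\<exists>x\<in>X0. lp_norm p (x - y) < \<epsilon>" if "y \<in> lp p" "\<epsilon> > 0" for y \<epsilon>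
    using dense' that by simp
  have S: "S k x \<in> lp p" if "x \<in> X0" for k x
    using S' that by simp
  have collapse: "(\<lambda>k. lp_norm p ((T i ^^ nk k) x)) \<longlonglongrightarrow> 0" if "x \<in> X0" "i \<in> {1..N}" for x i
    using collapse' that by simp
  have blowup: "\<exists>k\<ge>K. lp_norm p (S k x) < \<epsilon> \<and>
      (\<forall>i\<in>{1..N}. lp_norm p ((T i ^^ nk k) (S k x) - x) < \<epsilon>)" if "\<epsilon> > 0" "x \<in> X0" for \<epsilon> K x
    using blowup' that by simp
  obtain V :: "nat \<Rightarrow> nat \<Rightarrow> 'k" where V: "\<And>n. \<exists>M. full_support M (V n)"
    "\<And>M x \<epsilon> K. full_support M x \<Longrightarrow> \<epsilon> > 0 \<Longrightarrow>
       \<exists>n\<ge>K. full_support M (V n) \<and> (\<forall>m. norm (V n m - x m) < \<epsilon>)"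
    using countable_dense_full_support by metis
  have V_lp: "V j \<in> lp p" for j using V(1)[of j] full_support_lp[OF p] by blast
  obtain C where C: "C \<ge> 1"
    and C_bound': "\<forall>i\<in>{1..N}. \<forall>x\<in>lp p. \<forall>n.
      (T i ^^ n) x \<in> lp p \<and> lp_norm p ((T i ^^ n) x) \<le> C ^ n * lp_norm p x"
    using T_uniformly_bounded by blast
  have C_bound: "lp_norm p ((T i ^^ n) x) \<le> C ^ n * lp_norm p x"
    if "i \<in> {1..N}" "x \<in> lp p" for i x n
    using C_bound' that by blast
  define collapsing where "collapsing = (\<lambda>z. z \<in> lp p \<and> (\<forall>i\<in>{1..N}. (\<lambda>k. lp_norm p ((T i ^^ nk k) z)) \<longlonglongrightarrow> 0))"
  \<comment> \<open>One correction: \<open>z' = z + u\<close> with \<open>u\<close> in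
    \<open>X0\<close> close to \<open>v = S k' x0\<close>, where \<open>x0\<close> in
    \<open>X0\<close> is close to \<open>y\<close>. With \<open>A = T i ^^ n\<close>, the error
    splits into \<open>A z\<close>, \<open>A u - A v\<close>, \<open>A v - x0\<close> and
    \<open>x0 - y\<close>, each allotted \<open>\<epsilon> / 4\<close>.\<close>
  have perturb: "\<exists>z' k'. k' > k \<and> collapsing z' \<and> lp_norm p (z' - z) < d \<and>
      (\<forall>i\<in>{1..N}. lp_norm p ((T i ^^ nk k') z' - y) < \<epsilon>)"
    if z: "collapsing z" and y: "y \<in> lp p" and d: "d > 0" and \<epsilon>: "\<epsilon> > 0" for z k y d \<epsilon>
  proof -
    have z_lp: "z \<in> lp p" using z by (simp add: collapsing_def)
    have z_collapse: "(\<lambda>k. lp_norm p ((T i ^^ nk k) z)) \<longlonglongrightarrow> 0" if "i \<in> {1..N}" for i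
      using z that unfolding collapsing_def by blast
    obtain x0 where x0: "x0 \<in> X0" "lp_norm p (x0 - y) < \<epsilon> / 4"
      using dense[OF y, of "\<epsilon> / 4"] \<epsilon> by auto
    then have x0_lp: "x0 \<in> lp p" using X0 by auto
    have "\<forall>\<^sub>F k in sequentially. \<forall>i\<in>{1..N}. lp_norm p ((T i ^^ nk k) z) < \<epsilon> / 4"
    proof (intro eventually_ball_finite ballI finite_atLeastAtMost)
      fix i assume "i \<in> {1..N}"
      from z_collapse[OF this] show "\<forall>\<^sub>F k in sequentially. lp_norm p ((T i ^^ nk k) z) < \<epsilon> / 4"
        by (rule order_tendstoD(2)) (use \<epsilon> in simp)
    qed
    then obtain K where K: "\<And>k. k \<ge> K \<Longrightarrow> \<forall>i\<in>{1..N}. lp_norm p ((T i ^^ nk k) z) < \<epsilon> / 4"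
      unfolding eventually_sequentially by blast
    obtain k' where k': "k' \<ge> max K (Suc k)" "lp_norm p (S k' x0) < min (d / 2) (\<epsilon> / 4)"
      "\<forall>i\<in>{1..N}. lp_norm p ((T i ^^ nk k') (S k' x0) - x0) < min (d / 2) (\<epsilon> / 4)"
      using blowup[of "min (d / 2) (\<epsilon> / 4)" x0 "max K (Suc k)"] x0(1) d \<epsilon> by auto
    define n where "n = nk k'"
    define v where "v = S k' x0"
    have v: "v \<in> lp p" using S[OF x0(1)] by (simp add: v_def)
    have Cn: "C ^ n > 0" using C by simp
    \<comment> \<open>The iterate may magnify \<open>u - v\<close> by \<open>C ^ n\<close>, but
      \<open>n\<close> is fixed before \<open>u\<close> is chosen. The bound \<open>d / 2\<close>,
      together with that on \<open>v\<close>, keeps \<open>u\<close> smaller than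
      \<open>d\<close>.\<close>
    define e where "e = min (d / 2) (\<epsilon> / (4 * C ^ n))"
    have "e > 0" using d \<epsilon> Cn by (simp add: e_def)
    then obtain u where u: "u \<in> X0" "lp_norm p (u - v) < e" using dense[OF v] by blast
    have u_lp: "u \<in> lp p" using u(1) X0 by auto
    have Ce: "C ^ n * e \<le> \<epsilon> / 4"
    proof -
      have "C ^ n * e \<le> C ^ n * (\<epsilon> / (4 * C ^ n))" using Cn by (intro mult_left_mono) (auto simp: e_def)
      also have "\<dots> = \<epsilon> / 4" using C by simp
      finally show ?thesis .
    qed
    define z' where "z' = (\<lambda>m. z m + u m)"
    have z'_lp: "z' \<in> lp p" unfolding z'_def by (rule lp_add(1)[OF p z_lp u_lp])
    have diffs: "z' - z = u" "z' - u = z" by (auto simp: z'_def)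
    have T_z': "(T i ^^ j) z' = (\<lambda>m. (T i ^^ j) z m + (T i ^^ j) u m)" if "i \<in> {1..N}" for i j
      using T_diff[OF that z'_lp z_lp, of j] unfolding diffs by (simp add: fun_eq_iff)
    have "(\<lambda>k. lp_norm p ((T i ^^ nk k) z')) \<longlonglongrightarrow> 0" if i: "i \<in> {1..N}" for i
    proof (rule tendsto_sandwich[of "\<lambda>_. 0"])
      show "(\<lambda>k. lp_norm p ((T i ^^ nk k) z) + lp_norm p ((T i ^^ nk k) u)) \<longlonglongrightarrow> 0"
        using tendsto_add[OF z_collapse[OF i] collapse[OF u(1) i]] by simp
      show "\<forall>\<^sub>F k in sequentially. lp_norm p ((T i ^^ nk k) z') \<le> lp_norm p ((T i ^^ nk k) z) + lp_norm p ((T i ^^ nk k) u)"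
        unfolding T_z'[OF i] by (intro always_eventually allI lp_add(2)[OF p] T_funpow_lp i z_lp u_lp)
    qed auto
    then have "collapsing z'" using z'_lp by (simp add: collapsing_def)
    moreover have "lp_norm p (z' - z) < d"
    proof -
      have "lp_norm p u \<le> lp_norm p (u - v) + lp_norm p v" by (rule lp_norm_le_diff[OF p u_lp v])
      then show ?thesis unfolding diffs using u(2) k'(2) by (simp add: e_def v_def)
    qed
    moreover have "lp_norm p ((T i ^^ n) z' - y) < \<epsilon>" if i: "i \<in> {1..N}" for i
    proof -
      note lp = T_funpow_lp[OF i, of _ n]
      have "lp_norm p ((T i ^^ n) u - (T i ^^ n) v) \<le> C ^ n * lp_norm p (u - v)"
        using C_bound[OF i lp_diff[OF p u_lp v], of n] by (simp add: T_diff[OF i u_lp v])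
      also have "\<dots> \<le> C ^ n * e" using u(2) Cn by (intro mult_left_mono) auto
      finally have uv: "lp_norm p ((T i ^^ n) u - (T i ^^ n) v) \<le> \<epsilon> / 4" using Ce by simp
      have zu: "lp_norm p ((T i ^^ n) z' - (T i ^^ n) u) < \<epsilon> / 4"
        unfolding T_diff[OF i z'_lp u_lp, symmetric] diffs using K[of k'] k'(1) i
        unfolding n_def by simp
      have vx: "lp_norm p ((T i ^^ n) v - x0) < \<epsilon> / 4"
        using k'(3) i unfolding n_def v_def by simp
      show ?thesis
        using lp_norm_triangle[OF p lp[OF z'_lp] lp[OF u_lp] y] lp_norm_triangle[OF p lp[OF u_lp] lp[OF v] y]
          lp_norm_triangle[OF p lp[OF v] x0_lp y] uv zu vx x0(2) by linarith
    qed
    ultimately show ?thesis using k'(1) unfolding n_def by (intro exI[of _ z'] exI[of _ k']) auto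
  qed
  define P where "P = (\<lambda>j (z, k). collapsing z \<and> (\<forall>i\<in>{1..N}. lp_norm p ((T i ^^ nk k) z - V j) < (1 / 2) ^ j))"
  \<comment> \<open>Dividing by \<open>C ^ nk k\<close> protects the approximation achieved at time
    \<open>nk k\<close>: the image of the next correction under that iterate has norm at most
    \<open>(1 / 2) ^ Suc j\<close>.\<close>
  define Q where "Q = (\<lambda>j (z :: nat \<Rightarrow> 'k, k) (z', k'). k < k' \<and> lp_norm p (z' - z) < (1 / 2) ^ Suc j / C ^ nk k)"
  have "\<exists>s. \<forall>j. P j (s j) \<and> Q j (s j) (s (Suc j))"
  proof (rule dependent_nat_choice)
    have "lp_norm p (\<lambda>_. 0 :: 'k) = 0" by (simp add: lp_norm_def)
    moreover have "(T i ^^ n) (\<lambda>_. 0) = (\<lambda>_. 0)" if "i \<in> {1..N}" for i n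
      using pseudo_shift_funpow[OF data[OF that], of "\<lambda>_. 0" n] by (auto simp: fun_eq_iff)
    ultimately have "collapsing (\<lambda>_. 0)" by (simp add: collapsing_def lp_def)
    from perturb[OF this V_lp[of 0], of 1 1 0]
    obtain z' k' where "collapsing z'" "\<forall>i\<in>{1..N}. lp_norm p ((T i ^^ nk k') z' - V 0) < 1"
      by auto
    then show "\<exists>x. P 0 x" by (intro exI[of _ "(z', k')"]) (simp add: P_def)
  next
    fix s :: "(nat \<Rightarrow> 'k) \<times> nat" and j
    assume "P j s"
    moreover obtain z k where s: "s = (z, k)" by (cases s)
    ultimately have "collapsing z" by (simp add: P_def)
    have "0 < (1 / 2) ^ Suc j / C ^ nk k" "0 < (1 / 2 :: real) ^ Suc j" using C by simp_all
    from perturb[OF \<open>collapsing z\<close> V_lp[of "Suc j"] this, of k]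
    obtain z' k' where "k < k'" "collapsing z'" "lp_norm p (z' - z) < (1 / 2) ^ Suc j / C ^ nk k"
      "\<forall>i\<in>{1..N}. lp_norm p ((T i ^^ nk k') z' - V (Suc j)) < (1 / 2) ^ Suc j"
      by blast
    then show "\<exists>y. P (Suc j) y \<and> Q j s y"
      by (intro exI[of _ "(z', k')"]) (simp only: P_def Q_def s prod.case simp_thms)
  qed
  then obtain s where s: "\<And>j. P j (s j)" "\<And>j. Q j (s j) (s (Suc j))" by blast
  define z where "z = (\<lambda>j. fst (s j))"
  define \<kappa> where "\<kappa> = (\<lambda>j. nk (snd (s j)))"
  have z_lp: "z j \<in> lp p" for j
    using s(1)[of j] by (auto simp: P_def z_def collapsing_def split: prod.splits)
  have start: "lp_norm p ((T i ^^ \<kappa> j) (z j) - V j) < (1 / 2) ^ j" if "i \<in> {1..N}" for i j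
    using s(1)[of j] that by (auto simp: P_def z_def \<kappa>_def split: prod.splits)
  have step: "lp_norm p (z (Suc j) - z j) < (1 / 2) ^ Suc j / C ^ \<kappa> j" for j
    using s(2)[of j] by (auto simp: Q_def z_def \<kappa>_def split: prod.splits)
  \<comment> \<open>The times increase and \<open>C \<ge> 1\<close>, so the bound imposed at stage
    \<open>J\<close> protects all earlier stages as well.\<close>
  have \<kappa>_mono: "mono \<kappa>"
  proof (rule incseq_SucI)
    fix j
    have "snd (s j) < snd (s (Suc j))" using s(2)[of j] by (auto simp: Q_def split: prod.splits)
    then show "\<kappa> j \<le> \<kappa> (Suc j)" using mono by (simp add: \<kappa>_def strict_mono_less_eq)
  qed
  have small: "C ^ \<kappa> j * lp_norm p (z (Suc J) - z J) \<le> (1 / 2) ^ Suc J" if "j \<le> J" for j J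
  proof -
    have "C ^ \<kappa> j * lp_norm p (z (Suc J) - z J) \<le> C ^ \<kappa> J * ((1 / 2) ^ Suc J / C ^ \<kappa> J)"
      using C step[of J] monoD[OF \<kappa>_mono that] by (intro mult_mono power_increasing) auto
    then show ?thesis using C by simp
  qed
  have small_z: "lp_norm p (z (Suc J) - z J) \<le> (1 / 2) ^ Suc J" for J
    using small[of J J] mult_right_mono[of 1 "C ^ \<kappa> J" "lp_norm p (z (Suc J) - z J)"] C by simp
  \<comment> \<open>The limit is taken coordinatewise in the complete scalar field;
    \<open>lp_fatou\<close> then places it in \<open>lp p\<close>.\<close>
  define x where "x = (\<lambda>m. lim (\<lambda>J. z J m))"
  have "convergent (\<lambda>J. z J m)" for m
  proof -
    have le: "norm (z (Suc J) m - z J m) \<le> (1 / 2) ^ Suc J" for J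
      using norm_le_lp_norm[OF p lp_diff[OF p z_lp z_lp], of "Suc J" J m] small_z[of J] by simp
    have "summable (\<lambda>J. (1 / 2 :: real) ^ Suc J)"
      using summable_mult[OF summable_geometric[of "1 / 2 :: real"], of "1 / 2"] by simp
    then have "summable (\<lambda>J. norm (z (Suc J) m - z J m))"
      by (rule summable_comparison_test'[of _ 0]) (use le in simp)
    then have "summable (\<lambda>J. z (Suc J) m - z J m)" by (rule summable_norm_cancel)
    then have "convergent (\<lambda>J. z 0 m + (\<Sum>l<J. z (Suc l) m - z l m))"
      by (intro convergent_add convergent_const) (simp add: summable_iff_convergent)
    then show ?thesis using sum_lessThan_telescope[of "\<lambda>l. z l m"] by simp
  qed
  then have z_lim: "(\<lambda>J. z J m) \<longlonglongrightarrow> x m" for m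
    unfolding x_def by (simp add: convergent_LIMSEQ_iff)
  \<comment> \<open>The subtracted \<open>(1 / 2) ^ J\<close> leaves room for the next step, so that
    the induction closes.\<close>
  have bounded: "lp_norm p (z J) \<le> lp_norm p (z 0) + 1 - (1 / 2) ^ J" for J
  proof (induction J)
    case (Suc J)
    have "lp_norm p (z (Suc J)) \<le> lp_norm p (z (Suc J) - z J) + lp_norm p (z J)"
      by (intro lp_norm_le_diff p z_lp)
    then show ?case using Suc small_z[of J] by simp
  qed simp
  have "lp_norm p (z J) \<le> lp_norm p (z 0) + 1" for J
    using bounded[of J] by (rule order.trans) simp
  then have x: "x \<in> lp p"
    using lp_fatou(1)[of p z "lp_norm p (z 0) + 1" x] p z_lp z_lim by simp
  have near: "lp_norm p ((T i ^^ \<kappa> j) x - V j) \<le> 2 * (1 / 2) ^ j" if i: "i \<in> {1..N}" for i j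
  proof (rule lp_fatou(2)[OF p])
    note lp = T_funpow_lp[OF i z_lp, of "\<kappa> j"]
    show "(T i ^^ \<kappa> j) (z J) - V j \<in> lp p" for J
      by (intro lp_diff p lp V_lp)
    \<comment> \<open>The initial error is below \<open>(1 / 2) ^ j\<close> and the later
      corrections add up to at most as much, whence the factor 2.\<close>
    have "lp_norm p ((T i ^^ \<kappa> j) (z J) - V j) \<le> 2 * (1 / 2) ^ j - (1 / 2) ^ J" if "j \<le> J" for J
      using that
    proof (induction J rule: dec_induct)
      case base
      show ?case using start[OF i, of j] by linarith
    next
      case (step J)
      have "lp_norm p ((T i ^^ \<kappa> j) (z (Suc J)) - (T i ^^ \<kappa> j) (z J)) \<le> C ^ \<kappa> j * lp_norm p (z (Suc J) - z J)"
        using C_bound[OF i lp_diff[OF p z_lp z_lp], of "\<kappa> j" "Suc J" J]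
        by (simp add: T_diff[OF i z_lp z_lp])
      also have "\<dots> \<le> (1 / 2) ^ Suc J" by (rule small[OF step.hyps(1)])
      finally show ?case
        using step.IH lp_norm_triangle[OF p lp[of "Suc J"] lp[of J] V_lp[of j]]
        unfolding power_Suc by linarith
    qed
    moreover have "2 * (1 / 2) ^ j - (1 / 2) ^ J \<le> (2 :: real) * (1 / 2) ^ j" for J by simp
    ultimately show "\<forall>\<^sub>F J in sequentially. lp_norm p ((T i ^^ \<kappa> j) (z J) - V j) \<le> 2 * (1 / 2) ^ j"
      unfolding eventually_sequentially by (meson order.trans)
    show "(\<lambda>J. ((T i ^^ \<kappa> j) (z J) - V j) m) \<longlonglongrightarrow> ((T i ^^ \<kappa> j) x - V j) m" for m
    proof (cases "m = 0")
      case True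
      have "(T i ^^ \<kappa> j) u 0 = 0" if "u \<in> lp p" for u
        using T_funpow_0[of i u "\<kappa> j"] i lp_at_0[OF that] by simp
      then show ?thesis using True x z_lp by simp
    next
      case False
      have "(\<lambda>J. W i m (\<kappa> j) * z J (F i (\<kappa> j) m) - V j m) \<longlonglongrightarrow> W i m (\<kappa> j) * x (F i (\<kappa> j) m) - V j m"
        by (intro tendsto_intros z_lim)
      moreover have "(T i ^^ \<kappa> j) u m = W i m (\<kappa> j) * u (F i (\<kappa> j) m)" if "u \<in> lp p" for u
        using T_funpow[of i u m "\<kappa> j"] i lp_at_0[OF that] False by simp
      ultimately show ?thesis using x z_lp by simp
    qed
  qed
  have "\<exists>n\<ge>1. \<forall>i\<in>{1..N}. lp_norm p ((T i ^^ n) x - y) < \<epsilon>" if y: "y \<in> lp p" and \<epsilon>: "\<epsilon> > 0" for y \<epsilon>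
  proof -
    obtain M b where b: "full_support M b" "lp_norm p (b - y) < \<epsilon> / 3"
      using full_support_dense[OF p y, of "\<epsilon> / 3"] \<epsilon> by auto
    have M: "M \<ge> 1" using full_supportD(1)[OF b(1)] .
    \<comment> \<open>\<open>near\<close> leaves the error \<open>2 * (1 / 2) ^ j\<close>, which is
      below \<open>\<epsilon> / 3\<close> for \<open>j \<ge> K\<close>; such a \<open>j\<close> with
      \<open>V j\<close> close to \<open>b\<close> exists because approximations recur arbitrarily
      late.\<close>
    obtain K where K: "(1 / 2 :: real) ^ K < \<epsilon> / 6"
      using real_arch_pow_inv[of "\<epsilon> / 6" "1 / 2"] \<epsilon> by auto
    define \<delta> where "\<delta> = \<epsilon> / (3 * M)"
    have \<delta>: "\<delta> > 0" "M * \<delta> = \<epsilon> / 3" using \<epsilon> M by (auto simp: \<delta>_def)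
    obtain j where j: "j \<ge> K" "full_support M (V j)" "\<And>m. norm (V j m - b m) < \<delta>"
      using V(2)[OF b(1) \<delta>(1)] by blast
    have Vb: "lp_norm p (V j - b) \<le> \<epsilon> / 3"
      using lp_finite_support(2)[OF p, of "V j - b" "{1..M}" \<delta>] j(3) \<delta>(2)
        full_supportD[OF b(1)] full_supportD[OF j(2)] by (auto intro: less_imp_le)
    have "(1 / 2 :: real) ^ j \<le> (1 / 2) ^ K" using j(1) by (intro power_decreasing) auto
    then have near': "lp_norm p ((T i ^^ \<kappa> j) x - V j) < \<epsilon> / 3" if "i \<in> {1..N}" for i
      using near[OF that, of j] K by linarith
    have "lp_norm p ((T i ^^ \<kappa> j) x - y) < \<epsilon>" if "i \<in> {1..N}" for i
    proof -
      have "lp_norm p ((T i ^^ \<kappa> j) x - y)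
          \<le> lp_norm p ((T i ^^ \<kappa> j) x - V j) + lp_norm p (V j - y)"
        by (intro lp_norm_triangle p T_funpow_lp that x V_lp y)
      also have "lp_norm p (V j - y) \<le> lp_norm p (V j - b) + lp_norm p (b - y)"
        by (intro lp_norm_triangle p full_support_lp[OF p b(1)] V_lp y)
      finally show ?thesis using near'[OF that] Vb b(2) by linarith
    qed
    moreover have "\<kappa> j \<ge> 1" using nk by (simp add: \<kappa>_def)
    ultimately show ?thesis by blast
  qed
  then show ?thesis unfolding s_hypercyclic_def using x by blast
qed

end

theorem theorem3p3:
  fixes p :: real and N :: nat
    and f :: "nat \<Rightarrow> nat \<Rightarrow> nat"
    and w :: "nat \<Rightarrow> nat \<Rightarrow> 'k::{real_normed_field, banach}"
  assumes "1 \<le> p" and "N \<ge> 2"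
    and "\<And>i. i \<in> {1..N} \<Longrightarrow> pseudo_shift_data (f i) (w i)"
  shows "(s_hypercyclic p N (\<lambda>i. pseudo_shift (f i) (w i))
            \<longleftrightarrow> simultaneous_blowup_collapse p N (\<lambda>i. pseudo_shift (f i) (w i)))
       \<and> (simultaneous_blowup_collapse p N (\<lambda>i. pseudo_shift (f i) (w i))
            \<longleftrightarrow> weight_condition N f w)"
proof -
  interpret pseudo_shift_family p N f w using assms(1,3) by unfold_locales
  have "1 \<le> N" using assms(2) by simp
  then show ?thesis
    using s_hypercyclic_imp_weight_condition weight_condition_imp_blowup_collapse
      blowup_collapse_imp_s_hypercyclic by blast
qed

end
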